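(* Let $\theta$ be an involution (automorphism of order $2$, not necessarily type preserving) of a spherical building $\Delta$. Then either $\theta$ maps every chamber to an opposite chamber, or $\theta$ fixes at least one simplex. In particular, every involution of a finite irreducible thick spherical building of rank at least $3$ fixes some simplex.
   Context: Simplices of the building correspond to residues (a $J$-residue corresponding to a simplex of type $S\setminus J$); $\theta$ fixes a simplex means it maps some simplex (residue) to itself. Chambers are opposite if their Weyl distance is the longest element of $W$. Thick: every panel contains at least three chambers. *)

theory Defs
  imports "HOL-Algebra.Generated_Groups" "HOL-Algebra.Multiplicative_Group"
begin

definition word_prod :: "('w, 'm) monoid_scheme \<Rightarrow> 'w list \<Rightarrow> 'w" where
  "word_prod W u = foldr (\<otimes>\<^bsub>W\<^esub>) u \<one>\<^bsub>W\<^esub>"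

text \<open>
  The congruence on words over \<open>S\<close> generated by the relations \<open>(s t)\<^sup>m = 1\<close>, where \<open>m\<close> is the
  order of \<open>s t\<close>. An element of infinite order has \<open>ord = 0\<close>, so that no relation is imposed in
  that case. For \<open>s = t\<close> the relation is \<open>s s = 1\<close>; hence the letters are their own inverses
  and words in \<open>S\<close> modulo this congruence form the presented group.
\<close>

inductive coxeter_rel :: "('w, 'm) monoid_scheme \<Rightarrow> 'w set \<Rightarrow> 'w list \<Rightarrow> 'w list \<Rightarrow> bool"
  for W S where
  refl: "u \<in> lists S \<Longrightarrow> coxeter_rel W S u u"
| sym: "coxeter_rel W S u v \<Longrightarrow> coxeter_rel W S v u"
| trans: "coxeter_rel W S u v \<Longrightarrow> coxeter_rel W S v w \<Longrightarrow> coxeter_rel W S u w"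
| relator: "s \<in> S \<Longrightarrow> t \<in> S \<Longrightarrow> u \<in> lists S \<Longrightarrow> v \<in> lists S \<Longrightarrow>
    coxeter_rel W S (u @ concat (replicate (group.ord W (s \<otimes>\<^bsub>W\<^esub> t)) [s, t]) @ v) (u @ v)"

text \<open>
  \<open>(W, S)\<close> is a Coxeter system: \<open>S\<close> is a set of generators of order 2, and the relations
  \<open>(s t)\<^sup>m = 1\<close> above form a presentation of \<open>W\<close>.
\<close>

locale coxeter_system = group W for W (structure) +
  fixes S
  assumes gens_in_carrier: "S \<subseteq> carrier W"
    and gens_generate: "generate W S = carrier W"
    and gens_order_2: "s \<in> S \<Longrightarrow> ord s = 2"
    and presentation: "\<lbrakk>u \<in> lists S; v \<in> lists S; word_prod W u = word_prod W v\<rbrakk>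
      \<Longrightarrow> coxeter_rel W S u v"

definition cox_length :: "('w, 'm) monoid_scheme \<Rightarrow> 'w set \<Rightarrow> 'w \<Rightarrow> nat" where
  "cox_length W S w = (LEAST n. \<exists>u \<in> lists S. length u = n \<and> word_prod W u = w)"

definition longest_element :: "('w, 'm) monoid_scheme \<Rightarrow> 'w set \<Rightarrow> 'w \<Rightarrow> bool" where
  "longest_element W S w \<longleftrightarrow> is_arg_max (cox_length W S) (\<lambda>v. v \<in> carrier W) w"

definition coxeter_irreducible :: "('w, 'm) monoid_scheme \<Rightarrow> 'w set \<Rightarrow> bool" where
  "coxeter_irreducible W S \<longleftrightarrow> S \<noteq> {} \<and>
    \<not> (\<exists>A B. A \<noteq> {} \<and> B \<noteq> {} \<and> A \<union> B = S \<and> A \<inter> B = {} \<and>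
          (\<forall>a\<in>A. \<forall>b\<in>B. a \<otimes>\<^bsub>W\<^esub> b = b \<otimes>\<^bsub>W\<^esub> a))"

text \<open>
  Buildings of type \<open>(W, S)\<close> as \<open>W\<close>-metric spaces: \<open>Ch\<close> is the set of chambers and \<open>\<delta>\<close> the Weyl
  distance. Thickness is not required.
\<close>

locale building = coxeter_system W S for W (structure) and S +
  fixes Ch :: "'c set" and \<delta> :: "'c \<Rightarrow> 'c \<Rightarrow> 'a"
  assumes nonempty: "Ch \<noteq> {}"
    and dist_closed: "\<lbrakk>x \<in> Ch; y \<in> Ch\<rbrakk> \<Longrightarrow> \<delta> x y \<in> carrier W"
    and WD1: "\<lbrakk>x \<in> Ch; y \<in> Ch\<rbrakk> \<Longrightarrow> \<delta> x y = \<one> \<longleftrightarrow> x = y"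
    and WD2: "\<lbrakk>x \<in> Ch; y \<in> Ch; x' \<in> Ch; s \<in> S; \<delta> x' x = s\<rbrakk>
      \<Longrightarrow> \<delta> x' y \<in> {s \<otimes> \<delta> x y, \<delta> x y} \<and>
          (cox_length W S (s \<otimes> \<delta> x y) = cox_length W S (\<delta> x y) + 1
             \<longrightarrow> \<delta> x' y = s \<otimes> \<delta> x y)"
    and WD3: "\<lbrakk>x \<in> Ch; y \<in> Ch; s \<in> S\<rbrakk>
      \<Longrightarrow> \<exists>x'\<in>Ch. \<delta> x' x = s \<and> \<delta> x' y = s \<otimes> \<delta> x y"

locale spherical_building = building +
  assumes finite_type: "finite (carrier W)"

definition opposite ::
  "('w, 'm) monoid_scheme \<Rightarrow> 'w set \<Rightarrow> ('c \<Rightarrow> 'c \<Rightarrow> 'w) \<Rightarrow> 'c \<Rightarrow> 'c \<Rightarrow> bool" where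
  "opposite W S \<delta> x y \<longleftrightarrow> longest_element W S (\<delta> x y)"

definition is_residue ::
  "('w, 'm) monoid_scheme \<Rightarrow> 'c set \<Rightarrow> ('c \<Rightarrow> 'c \<Rightarrow> 'w) \<Rightarrow> 'w set \<Rightarrow> 'c set \<Rightarrow> bool" where
  "is_residue W Ch \<delta> J R \<longleftrightarrow> (\<exists>x\<in>Ch. R = {y \<in> Ch. \<delta> x y \<in> generate W J})"

definition thick ::
  "('w, 'm) monoid_scheme \<Rightarrow> 'w set \<Rightarrow> 'c set \<Rightarrow> ('c \<Rightarrow> 'c \<Rightarrow> 'w) \<Rightarrow> bool" where
  "thick W S Ch \<delta> \<longleftrightarrow>
    (\<forall>s\<in>S. \<forall>R. is_residue W Ch \<delta> {s} R \<longrightarrow> infinite R \<or> 3 \<le> card R)"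

text \<open>
  Automorphisms need not preserve types: the permutation of chambers is accompanied by an
  automorphism \<open>\<sigma>\<close> of the Coxeter system.
\<close>

definition building_automorphism ::
  "('w, 'm) monoid_scheme \<Rightarrow> 'w set \<Rightarrow> 'c set \<Rightarrow> ('c \<Rightarrow> 'c \<Rightarrow> 'w) \<Rightarrow> ('c \<Rightarrow> 'c) \<Rightarrow> bool" where
  "building_automorphism W S Ch \<delta> \<theta> \<longleftrightarrow> bij_betw \<theta> Ch Ch \<and>
    (\<exists>\<sigma> \<in> iso W W. \<sigma> ` S = S \<and> (\<forall>x\<in>Ch. \<forall>y\<in>Ch. \<delta> (\<theta> x) (\<theta> y) = \<sigma> (\<delta> x y)))"

definition building_involution ::
  "('w, 'm) monoid_scheme \<Rightarrow> 'w set \<Rightarrow> 'c set \<Rightarrow> ('c \<Rightarrow> 'c \<Rightarrow> 'w) \<Rightarrow> ('c \<Rightarrow> 'c) \<Rightarrow> bool" where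
  "building_involution W S Ch \<delta> \<theta> \<longleftrightarrow> building_automorphism W S Ch \<delta> \<theta> \<and>
    (\<forall>x\<in>Ch. \<theta> (\<theta> x) = x) \<and> (\<exists>x\<in>Ch. \<theta> x \<noteq> x)"

text \<open>
  A \<open>J\<close>-residue is a simplex of type \<open>S - J\<close>. The case \<open>J = S\<close>, in which the residue is the whole
  building, corresponds to the empty simplex and is excluded.
\<close>

definition fixes_simplex ::
  "('w, 'm) monoid_scheme \<Rightarrow> 'w set \<Rightarrow> 'c set \<Rightarrow> ('c \<Rightarrow> 'c \<Rightarrow> 'w) \<Rightarrow> ('c \<Rightarrow> 'c) \<Rightarrow> bool" where
  "fixes_simplex W S Ch \<delta> \<theta> \<longleftrightarrow>
    (\<exists>J R. J \<subset> S \<and> is_residue W Ch \<delta> J R \<and> \<theta> ` R = R)"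

end

theory Submission
  imports Defs "HOL-Number_Theory.Cong"
begin

text \<open>
  Choose a chamber \<open>x\<close> whose displacement \<open>w = \<delta> x (\<theta> x)\<close> has minimal length, let \<open>\<sigma>\<close> be the
  action of \<open>\<theta>\<close> on types and \<open>J\<close> the set of left descents of \<open>w\<close>. Moving \<open>x\<close> across an
  \<open>s\<close>-panel, \<open>s \<in> J\<close>, minimality and the exchange condition give \<open>s w = w \<sigma>(s)\<close>. Write \<open>w = a v\<close>
  with \<open>a \<in> W\<^sub>J\<close> and \<open>v\<close> of minimal length in \<open>W\<^sub>J w\<close>. Then also \<open>w = v \<sigma>(a)\<close>, so a left descent of
  \<open>v\<close> would be one of \<open>w\<close>, which is impossible; hence \<open>v = 1\<close>, \<open>w \<in> W\<^sub>J\<close>, and \<open>\<theta>\<close> stabilises the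
  \<open>J\<close>-residue of \<open>x\<close>. If \<open>J = S\<close>, then \<open>w\<close> is the longest element and every chamber is mapped to
  an opposite one.

  A finite irreducible Coxeter group of rank at least 3 has generators \<open>s\<close>, \<open>t\<close> with \<open>s t\<close> of order 3,
  since otherwise it contains arbitrarily long reduced words. If every chamber is mapped to an
  opposite one, then following \<open>\<theta>\<close> by the projection to an \<open>{s, t}\<close>-residue yields a polarity
  without absolute points of a finite thick projective plane. Joining a point to the points on its
  polar gives a friendship graph with all degrees at least 3. Such a graph is regular of some degree \<open>k\<close>;
  for a prime \<open>p\<close> dividing \<open>k - 1\<close> the number of closed walks of length \<open>p\<close> is 1 modulo \<open>p\<close>, whereas
  rotating these walks shows that it is divisible by \<open>p\<close>.
\<close>

section \<open>Friendship graphs and polarities\<close>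

text \<open>The orbits of \<open>f\<close> partition \<open>A\<close>. Each has exactly
  \<open>p\<close> elements, because the period of a point divides the prime \<open>p\<close> and
  differs from 1.\<close>

lemma prime_dvd_card_fixpoint_free:
  fixes p :: nat and f :: "'x \<Rightarrow> 'x"
  assumes p: "prime p" and fin: "finite A" and closed: "\<And>x. x \<in> A \<Longrightarrow> f x \<in> A"
    and period: "\<And>x. x \<in> A \<Longrightarrow> (f ^^ p) x = x" and free: "\<And>x. x \<in> A \<Longrightarrow> f x \<noteq> x"
  shows "p dvd card A"
proof -
  define orb where "orb x = (\<lambda>i. (f ^^ i) x) ` {..<p}" for x
  have p0: "p > 0" using p prime_gt_0_nat by blast
  have cl: "(f ^^ i) x \<in> A" if "x \<in> A" for i x
    using that by (induction i) (auto intro: closed)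
  have per: "(f ^^ (p * l)) x = x" if "x \<in> A" for l x
    using that by (induction l) (auto simp: funpow_add period)
  have red: "(f ^^ i) x = (f ^^ (i mod p)) x" if "x \<in> A" for i x
    using per[OF that, of "i div p"] funpow_add[of "i mod p" "p * (i div p)" f] by simp
  have orb_eq: "orb x = range (\<lambda>i. (f ^^ i) x)" if "x \<in> A" for x
  proof
    show "range (\<lambda>i. (f ^^ i) x) \<subseteq> orb x"
      unfolding orb_def using red[OF that] p0 by (auto intro!: image_eqI[where x = "_ mod p"])
  qed (auto simp: orb_def)
  \<comment> \<open>\<open>d\<close> is invertible modulo \<open>p\<close>, so some multiple of the
    period \<open>d\<close> is 1 modulo \<open>p\<close>, which forces
    \<open>f x = x\<close>.\<close>
  have no_fix: "(f ^^ d) x \<noteq> x" if x: "x \<in> A" and d: "0 < d" "d < p" for d x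
  proof
    assume fx: "(f ^^ d) x = x"
    have mult: "(f ^^ (d * k)) x = x" for k
      by (induction k) (auto simp: funpow_add fx)
    have "coprime d p"
      using p d by (metis coprime_commute dvd_imp_le linorder_not_less prime_imp_coprime)
    then obtain k where "[d * k = 1] (mod p)"
      using cong_solve_coprime_nat by auto
    then have "(d * k) mod p = 1"
      using p prime_gt_1_nat[of p] by (simp add: cong_def)
    then have "(f ^^ (d * k)) x = f x"
      using red[OF x, of "d * k"] by simp
    then show False using mult free[OF x] by simp
  qed
  have card_orb: "card (orb x) = p" if x: "x \<in> A" for x
  proof -
    have "inj_on (\<lambda>i. (f ^^ i) x) {..<p}"
    proof (rule linorder_inj_onI)
      fix i j assume ij: "i < j" "i \<in> {..<p}" "j \<in> {..<p}"
      show "(f ^^ i) x \<noteq> (f ^^ j) x"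
      proof
        assume "(f ^^ i) x = (f ^^ j) x"
        then have "(f ^^ (p - i)) ((f ^^ i) x) = (f ^^ (p - i)) ((f ^^ j) x)" by simp
        then have "(f ^^ (p - i + i)) x = (f ^^ (p - i + j)) x"
          by (simp add: funpow_add)
        moreover have "p - i + j = j - i + p" "p - i + i = p" using ij by auto
        ultimately have "(f ^^ (j - i)) ((f ^^ p) x) = x"
          using period[OF x] by (metis comp_apply funpow_add)
        then have "(f ^^ (j - i)) x = x" using period[OF x] by simp
        moreover have "0 < j - i" "j - i < p" using ij by auto
        ultimately show False using no_fix[OF x] by blast
      qed
    qed auto
    then show ?thesis by (simp add: orb_def card_image)
  qed
  have sub: "orb x \<subseteq> A" if "x \<in> A" for x
    using cl[OF that] by (auto simp: orb_def)
  have refl: "x \<in> orb x" if "x \<in> A" for x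
    using orb_eq[OF that] by (metis funpow_0 rangeI)
  have disj: "orb x = orb y" if xy: "x \<in> A" "y \<in> A" and z: "z \<in> orb x" "z \<in> orb y" for x y z
  proof -
    have *: "orb z = orb x" if x: "x \<in> A" and z: "z \<in> orb x" for x z
    proof -
      obtain i where i: "i < p" "z = (f ^^ i) x" using z by (auto simp: orb_def)
      have zA: "z \<in> A" using i cl x by auto
      have x_eq: "x = (f ^^ (p - i)) z"
        using i period[OF x] funpow_add[of "p - i" i f] by simp
      have "(f ^^ j) x = (f ^^ (j + (p - i))) z" for j
        using x_eq funpow_add[of j "p - i" f] by simp
      then have "orb x \<subseteq> orb z" unfolding orb_eq[OF x] orb_eq[OF zA] by blast
      moreover have "(f ^^ j) z = (f ^^ (j + i)) x" for j
        using i funpow_add[of j i f] by simp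
      then have "orb z \<subseteq> orb x" unfolding orb_eq[OF x] orb_eq[OF zA] by blast
      ultimately show ?thesis by simp
    qed
    show ?thesis using *[OF xy(1) z(1)] *[OF xy(2) z(2)] by simp
  qed
  have "\<Union> (orb ` A) = A" using sub refl by blast
  moreover have "p dvd card (\<Union> (orb ` A))"
  proof (rule dvd_partition)
    show "finite (\<Union> (orb ` A))" using \<open>\<Union> (orb ` A) = A\<close> fin by simp
    show "\<forall>c\<in>orb ` A. p dvd card c" using card_orb by auto
    show "\<forall>c1\<in>orb ` A. \<forall>c2\<in>orb ` A. c1 \<noteq> c2 \<longrightarrow> c1 \<inter> c2 = {}" using disj by blast
  qed
  ultimately show ?thesis by simp
qed

text \<open>Once the graph is regular of degree \<open>k\<close>, any two vertices have
  \<open>k\<close> or 1 common neighbours, according as they are equal or not. Both numbers are 1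
  modulo a prime dividing \<open>k - 1\<close>, so modulo that prime closed walks can be counted
  like open ones. The degree bound makes \<open>k - 1\<close> have a prime divisor and excludes the
  windmill graphs.\<close>

lemma no_friendship_graph_degree_ge_3:
  fixes V :: "'v set" and E :: "'v \<Rightarrow> 'v \<Rightarrow> bool"
  assumes fin: "finite V" and ne: "V \<noteq> {}"
    and sym: "\<And>x y. \<lbrakk>x \<in> V; y \<in> V; E x y\<rbrakk> \<Longrightarrow> E y x"
    and irr: "\<And>x. x \<in> V \<Longrightarrow> \<not> E x x"
    and friend: "\<And>x y. \<lbrakk>x \<in> V; y \<in> V; x \<noteq> y\<rbrakk> \<Longrightarrow> \<exists>!z. z \<in> V \<and> E x z \<and> E y z"
    and deg: "\<And>x. x \<in> V \<Longrightarrow> 3 \<le> card {y \<in> V. E x y}"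
  shows False
proof -
  define N where "N x = {y \<in> V. E x y}" for x
  have finN: "finite (N x)" for x using fin by (simp add: N_def)
  have CN1: "card (N x \<inter> N y) = 1" if xy: "x \<in> V" "y \<in> V" "x \<noteq> y" for x y
  proof -
    obtain z where "z \<in> V \<and> E x z \<and> E y z" "\<forall>z'. z' \<in> V \<and> E x z' \<and> E y z' \<longrightarrow> z' = z"
      using friend[OF xy] unfolding Ex1_def by blast
    then have "N x \<inter> N y = {z}" unfolding N_def by blast
    then show ?thesis by simp
  qed
  have uniq: "z = z'" if "x \<in> V" "y \<in> V" "x \<noteq> y" "z \<in> N x" "z \<in> N y" "z' \<in> N x" "z' \<in> N y" for x y z z'
    using friend[OF that(1-3)] that(4-) unfolding N_def by blast
  have symN: "y \<in> N x \<longleftrightarrow> x \<in> N y" if "x \<in> V" "y \<in> V" for x y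
    using sym[of x y] sym[of y x] that unfolding N_def by blast
  have le: "card (N v) \<le> card (N w)" if v: "v \<in> V" and w: "w \<in> V" and vw: "v \<noteq> w" and nonadj: "w \<notin> N v" for v w
  proof -
    have "\<forall>u\<in>N v. \<exists>z. z \<in> N u \<and> z \<in> N w"
    proof
      fix u assume u: "u \<in> N v"
      then have "u \<in> V" "u \<noteq> w" using nonadj by (auto simp: N_def)
      then show "\<exists>z. z \<in> N u \<and> z \<in> N w"
        using ex1_implies_ex[OF friend[of u w]] w unfolding N_def by blast
    qed
    \<comment> \<open>\<open>g\<close> sends a neighbour \<open>u\<close> of \<open>v\<close> to the
      common neighbour of \<open>u\<close> and \<open>w\<close>. It is injective: \<open>g a\<close>
      differs from \<open>v\<close>, as \<open>v\<close> and \<open>w\<close> are not adjacent, so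
      \<open>v\<close> and \<open>g a\<close> have only one common neighbour.\<close>
    then obtain g where g: "\<And>u. u \<in> N v \<Longrightarrow> g u \<in> N u \<and> g u \<in> N w" by metis
    have "inj_on g (N v)"
    proof (rule inj_onI)
      fix a b assume ab: "a \<in> N v" "b \<in> N v" "g a = g b"
      have V: "a \<in> V" "b \<in> V" "g a \<in> V" using ab g[OF ab(1)] by (auto simp: N_def)
      have "v \<noteq> g a" using g[OF ab(1)] nonadj symN[OF v w] by auto
      moreover have "a \<in> N (g a)" "b \<in> N (g a)"
        using g[OF ab(1)] g[OF ab(2)] ab(3) symN V by auto
      ultimately show "a = b" using uniq[OF v V(3)] ab by blast
    qed
    then show ?thesis using g finN by (intro card_inj_on_le[of g]) auto
  qed
  have nonadj_eq: "card (N v) = card (N w)" if "v \<in> V" "w \<in> V" "v \<noteq> w" "w \<notin> N v" for v w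
    using le[of v w] le[of w v] that symN[of v w] by auto
  obtain x0 where x0: "x0 \<in> V" using ne by blast
  define k where "k = card (N x0)"
  have k3: "3 \<le> k" using deg[OF x0] by (simp add: k_def N_def)
  have no_hub: False if a: "a \<in> V" and hub: "\<And>b. b \<in> V \<Longrightarrow> b \<noteq> a \<Longrightarrow> b \<in> N a" for a
  proof -
    have "3 \<le> card (N a)" using deg[OF a] by (simp add: N_def)
    then obtain b where b: "b \<in> N a" by fastforce
    then have bV: "b \<in> V" "b \<noteq> a" using irr[OF a] by (auto simp: N_def)
    \<comment> \<open>A neighbour of \<open>b\<close> other than the hub \<open>a\<close> is a
      common neighbour of \<open>a\<close> and \<open>b\<close>, so \<open>b\<close> has degree at
      most 2.\<close>
    have "N b \<subseteq> insert a (N a \<inter> N b)" using hub by (auto simp: N_def)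
    then have "card (N b) \<le> card (insert a (N a \<inter> N b))" using finN by (intro card_mono) auto
    also have "\<dots> \<le> 1 + card (N a \<inter> N b)" using finN by (simp add: card_insert_if)
    also have "\<dots> = 2" using CN1[of a b] a bV by simp
    finally show False using deg[OF bV(1)] by (simp add: N_def)
  qed
  have reg: "card (N x) = k" if x: "x \<in> V" for x
  proof (rule ccontr)
    assume neq: "card (N x) \<noteq> k"
    define A where "A = {y \<in> V. card (N y) = k}"
    define B where "B = {y \<in> V. card (N y) \<noteq> k}"
    have AB: "b \<in> N a" if "a \<in> A" "b \<in> B" for a b
      using nonadj_eq[of a b] that by (auto simp: A_def B_def)
    have BA: "a \<in> N b" if "a \<in> A" "b \<in> B" for a b
      using AB[OF that] symN that by (auto simp: A_def B_def)
    have x0A: "x0 \<in> A" and xB: "x \<in> B" using x0 x neq by (auto simp: A_def B_def k_def)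
    \<comment> \<open>Vertices of different degree are adjacent, so \<open>A\<close> and
      \<open>B\<close> are completely joined. Two vertices on each side would give a pair with two
      common neighbours; hence one side is a single vertex, which is a hub.\<close>
    have "(\<forall>a\<in>A. a = x0) \<or> (\<forall>b\<in>B. b = x)"
    proof (rule ccontr)
      assume "\<not> ?thesis"
      then obtain a b where ab: "a \<in> A" "a \<noteq> x0" "b \<in> B" "b \<noteq> x" by blast
      have "a \<in> V" using ab by (auto simp: A_def)
      from uniq[OF this x0 ab(2) AB[OF ab(1,3)] AB[OF x0A ab(3)] AB[OF ab(1) xB] AB[OF x0A xB]]
      show False using ab by simp
    qed
    then show False
    proof
      assume "\<forall>a\<in>A. a = x0"
      then have "b \<in> N x0" if "b \<in> V" "b \<noteq> x0" for b
        using that AB[OF x0A, of b] by (auto simp: A_def B_def)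
      then show False using no_hub[OF x0] by blast
    next
      assume "\<forall>b\<in>B. b = x"
      then have "a \<in> N x" if "a \<in> V" "a \<noteq> x" for a
        using that BA[OF _ xB, of a] by (auto simp: A_def B_def)
      then show False using no_hub[OF x] by blast
    qed
  qed
  have CN: "card (N x \<inter> N y) = (if x = y then k else 1)" if "x \<in> V" "y \<in> V" for x y
    using that CN1 reg by auto
  \<comment> \<open>Count the walks of length 2 from \<open>x0\<close> by their middle vertex and by
    their end. Adding \<open>k\<close> on the left avoids subtraction of natural numbers.\<close>
  have cardV: "card V + k = 1 + k * k"
  proof -
    have "(\<Sum>z\<in>N x0. card (N z)) = (\<Sum>z\<in>N x0. k)"
      by (intro sum.cong) (auto simp: N_def intro!: reg[unfolded N_def])
    then have "k * k = (\<Sum>z\<in>N x0. card (N z))" by (simp add: k_def)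
    also have "\<dots> = card (SIGMA z:N x0. N z)" using finN by simp
    also have "\<dots> = card (SIGMA y:V. N x0 \<inter> N y)"
    proof (rule bij_betw_same_card)
      show "bij_betw (\<lambda>(z, y). (y, z)) (SIGMA z:N x0. N z) (SIGMA y:V. N x0 \<inter> N y)"
        by (rule bij_betwI[where g = "\<lambda>(z, y). (y, z)"]) (auto simp: N_def intro: sym)
    qed
    also have "\<dots> = (\<Sum>y\<in>V. card (N x0 \<inter> N y))" using finN fin by simp
    also have "\<dots> = (\<Sum>y\<in>V. if x0 = y then k else 1)" using CN x0 by (intro sum.cong) auto
    also have "\<dots> = k + card (V - {x0})"
    proof -
      have "(\<Sum>y\<in>V - {x0}. if x0 = y then k else 1) = (\<Sum>y\<in>V - {x0}. 1)" by (rule sum.cong) auto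
      then show ?thesis by (simp add: sum.remove[OF fin x0] del: card_Diff_insert)
    qed
    also have "\<dots> = k + (card V - 1)" using x0 by simp
    finally show ?thesis using card_gt_0_iff[of V] fin ne by simp
  qed
  obtain p where p: "prime p" "p dvd k - 1"
  proof -
    have "k - 1 \<noteq> 1" using k3 by simp
    then show thesis using prime_factor_nat[of "k - 1"] that by blast
  qed
  have p2: "2 \<le> p" using p prime_ge_2_nat by blast
  have k1: "[k = 1] (mod p)" using p k3 by (simp add: cong_altdef_nat)
  have V1: "[card V = 1] (mod p)"
  proof -
    have "[card V + k = 1 + k * k] (mod p)" by (simp add: cardV)
    also have "[1 + k * k = 1 + 1 * k] (mod p)"
      by (intro cong_add cong_mult k1) auto
    finally show ?thesis using cong_add_rcancel_nat[of "card V" k 1 p] by simp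
  qed
  \<comment> \<open>Walks with \<open>m\<close> edges, hence with \<open>Suc m\<close>
    vertices.\<close>
  define Wk where "Wk m = {xs. length xs = Suc m \<and> set xs \<subseteq> V \<and> successively E xs}" for m
  have finW: "finite (Wk m)" for m
    by (rule finite_subset[OF _ finite_lists_length_eq[OF fin, of "Suc m"]]) (auto simp: Wk_def)
  have Wk_props: "xs \<noteq> [] \<and> hd xs \<in> V \<and> last xs \<in> V" if "xs \<in> Wk m" for xs m
  proof -
    have "xs \<noteq> []" using that by (auto simp: Wk_def)
    then show ?thesis using that by (auto simp: Wk_def)
  qed
  have cardW: "card (Wk m) = card V * k ^ m" for m
  proof (induction m)
    case 0
    have "Wk 0 = (\<lambda>x. [x]) ` V" by (auto simp: Wk_def length_Suc_conv)
    moreover have "inj_on (\<lambda>x. [x]) V" by (auto intro: inj_onI)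
    ultimately show ?case by (simp add: card_image)
  next
    case (Suc m)
    have "Wk (Suc m) = (\<lambda>(xs, x). x # xs) ` (SIGMA xs:Wk m. N (hd xs))" (is "_ = ?R")
    proof
      show "Wk (Suc m) \<subseteq> ?R"
      proof
        fix ys assume ys: "ys \<in> Wk (Suc m)"
        then obtain x y zs where e: "ys = x # y # zs" by (auto simp: Wk_def length_Suc_conv)
        then have "y # zs \<in> Wk m" "x \<in> N y" using ys by (auto simp: Wk_def N_def intro: sym)
        then show "ys \<in> ?R" using e by force
      qed
      show "?R \<subseteq> Wk (Suc m)"
      proof clarify
        fix xs x assume *: "xs \<in> Wk m" "x \<in> N (hd xs)"
        then have "x \<in> V" "E x (hd xs)" using Wk_props[OF *(1)] sym[of "hd xs" x] by (auto simp: N_def)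
        then show "x # xs \<in> Wk (Suc m)" using * by (auto simp: Wk_def successively_Cons)
      qed
    qed
    moreover have "inj_on (\<lambda>(xs, x). x # xs) (SIGMA xs:Wk m. N (hd xs))" by (auto intro: inj_onI)
    ultimately have "card (Wk (Suc m)) = card (SIGMA xs:Wk m. N (hd xs))" by (simp add: card_image)
    also have "\<dots> = (\<Sum>xs\<in>Wk m. card (N (hd xs)))" using finW finN by simp
    also have "\<dots> = (\<Sum>xs\<in>Wk m. k)" using Wk_props reg by (intro sum.cong) auto
    finally show ?case using Suc by simp
  qed
  \<comment> \<open>A closed walk does not repeat its starting vertex at the end; the closing edge
    is the last conjunct. In this form \<open>rotate1\<close> acts on closed walks.\<close>
  define C where "C = {xs. length xs = p \<and> set xs \<subseteq> V \<and> successively E xs \<and> E (last xs) (hd xs)}"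
  have finC: "finite C"
    by (rule finite_subset[OF _ finite_lists_length_eq[OF fin, of p]]) (auto simp: C_def)
  \<comment> \<open>Removing the first vertex of a closed walk leaves a walk with
    \<open>p - 2\<close> edges, and the removed vertex is a common neighbour of its two
    ends.\<close>
  define m where "m = p - 2"
  have pm: "p = Suc (Suc m)" using p2 by (simp add: m_def)
  have "C = (\<lambda>(xs, x). x # xs) ` (SIGMA xs:Wk m. N (hd xs) \<inter> N (last xs))" (is "_ = ?R")
  proof
    show "C \<subseteq> ?R"
    proof
      fix ys assume ys: "ys \<in> C"
      then obtain x y zs where e: "ys = x # y # zs" by (auto simp: C_def pm length_Suc_conv)
      have "last (y # zs) \<in> V" using ys e last_in_set[of "y # zs"] by (auto simp: C_def)
      then have "y # zs \<in> Wk m" "x \<in> N y \<inter> N (last (y # zs))"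
        using ys e by (auto simp: Wk_def C_def pm N_def intro: sym)
      then show "ys \<in> ?R" using e by force
    qed
    show "?R \<subseteq> C"
    proof clarify
      fix xs x assume *: "xs \<in> Wk m" "x \<in> N (hd xs)" "x \<in> N (last xs)"
      then have "x \<in> V" "E x (hd xs)" "E (last xs) x"
        using Wk_props[OF *(1)] sym[of "hd xs" x] by (auto simp: N_def)
      then show "x # xs \<in> C" using * Wk_props[OF *(1)] by (auto simp: Wk_def C_def pm successively_Cons)
    qed
  qed
  moreover have "inj_on (\<lambda>(xs, x). x # xs) (SIGMA xs:Wk m. N (hd xs) \<inter> N (last xs))" by (auto intro: inj_onI)
  ultimately have "card C = card (SIGMA xs:Wk m. N (hd xs) \<inter> N (last xs))" by (simp add: card_image)
  also have "\<dots> = (\<Sum>xs\<in>Wk m. card (N (hd xs) \<inter> N (last xs)))" using finW finN by simp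
  also have "\<dots> = (\<Sum>xs\<in>Wk m. if hd xs = last xs then k else 1)"
    using Wk_props CN by (intro sum.cong) auto
  also have "[\<dots> = (\<Sum>xs\<in>Wk m. 1)] (mod p)"
    using k1 by (intro cong_sum) auto
  also have "(\<Sum>xs\<in>Wk m. 1) = card V * k ^ m" by (simp add: cardW)
  also have "[card V * k ^ m = 1 * 1 ^ m] (mod p)"
    by (intro cong_mult cong_pow V1 k1)
  finally have C1: "[card C = 1] (mod p)" by simp
  have "p dvd card C"
  proof (rule prime_dvd_card_fixpoint_free[OF p(1) finC, of rotate1])
    fix xs assume xs: "xs \<in> C"
    then obtain x y zs where e: "xs = x # y # zs" by (auto simp: C_def pm length_Suc_conv)
    have "successively E ((y # zs) @ [x])"
      using xs e unfolding successively_append_iff by (auto simp: C_def)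
    then show "rotate1 xs \<in> C" using xs e by (auto simp: C_def)
    show "(rotate1 ^^ p) xs = xs" using xs rotate_id[of p xs] by (simp add: C_def rotate_def)
    \<comment> \<open>A list fixed by \<open>rotate1\<close> has equal first and second entries,
      which would be a loop of the graph.\<close>
    show "rotate1 xs \<noteq> xs"
      using xs e irr by (auto simp: C_def)
  qed
  then have "[card C = 0] (mod p)" by (simp add: cong_0_iff)
  then have "[1 = (0::nat)] (mod p)" using C1 cong_sym cong_trans by blast
  then show False using p2 by (simp add: cong_def)
qed

text \<open>The elements of \<open>R\<close> play the role of the flags of a projective plane:
  \<open>ps\<close> relates flags with the same point, \<open>pt\<close> flags with the same line,
  and \<open>\<phi>\<close> is the polarity. The friendship property holds because the common
  neighbour of two points is the pole of the line joining them.\<close>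

lemma no_polarity_without_absolute_points:
  fixes R :: "'c set" and ps pt :: "'c \<Rightarrow> 'c \<Rightarrow> bool" and \<phi> :: "'c \<Rightarrow> 'c"
  assumes fin: "finite R" and ne: "R \<noteq> {}"
    and closed: "\<And>c. c \<in> R \<Longrightarrow> \<phi> c \<in> R" and invol: "\<And>c. c \<in> R \<Longrightarrow> \<phi> (\<phi> c) = c"
    and ps_refl: "\<And>c. c \<in> R \<Longrightarrow> ps c c"
    and ps_sym: "\<And>c d. \<lbrakk>c \<in> R; d \<in> R; ps c d\<rbrakk> \<Longrightarrow> ps d c"
    and ps_trans: "\<And>c d e. \<lbrakk>c \<in> R; d \<in> R; e \<in> R; ps c d; ps d e\<rbrakk> \<Longrightarrow> ps c e"
    and flag: "\<And>c d. \<lbrakk>c \<in> R; d \<in> R; ps c d; pt c d\<rbrakk> \<Longrightarrow> c = d"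
    and swap: "\<And>c d. \<lbrakk>c \<in> R; d \<in> R; ps c d\<rbrakk> \<Longrightarrow> pt (\<phi> c) (\<phi> d)"
      "\<And>c d. \<lbrakk>c \<in> R; d \<in> R; pt c d\<rbrakk> \<Longrightarrow> ps (\<phi> c) (\<phi> d)"
    and absolute: "\<And>c. c \<in> R \<Longrightarrow> \<not> ps c (\<phi> c)"
    and line: "\<And>c d. \<lbrakk>c \<in> R; d \<in> R; \<not> ps c d\<rbrakk> \<Longrightarrow> \<exists>c'\<in>R. \<exists>d'\<in>R. ps c c' \<and> pt c' d' \<and> ps d' d"
    and line_unique: "\<And>c c' d d'. \<lbrakk>c \<in> R; c' \<in> R; d \<in> R; d' \<in> R; ps c c'; ps d d'; pt c d; pt c' d'; \<not> ps c d\<rbrakk>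
      \<Longrightarrow> c = c'"
    and thick: "\<And>c. c \<in> R \<Longrightarrow> 3 \<le> card {y \<in> R. ps c y}"
  shows False
proof -
  define cls where "cls c = {y \<in> R. ps c y}" for c
  \<comment> \<open>\<open>Q\<close> lies on the polar of \<open>P\<close>: as \<open>c\<close> runs
    through the flags of the point \<open>P\<close>, the points of the flags \<open>\<phi> c\<close>
    are the poles of the lines through \<open>P\<close>.\<close>
  define E where "E P Q \<longleftrightarrow> (\<exists>c\<in>P. \<phi> c \<in> Q)" for P Q
  have sub: "P \<subseteq> R" if "P \<in> cls ` R" for P using that by (auto simp: cls_def)
  have mem: "c \<in> cls c" if "c \<in> R" for c using that ps_refl by (simp add: cls_def)
  have cls_eq: "cls c = cls d" if "c \<in> R" "d \<in> R" "ps c d" for c d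
    using that ps_trans ps_sym unfolding cls_def by blast
  have rep: "P = cls c" if "P \<in> cls ` R" "c \<in> P" for P c
  proof -
    obtain d where "d \<in> R" "P = cls d" using \<open>P \<in> cls ` R\<close> by blast
    then show ?thesis using cls_eq[of d c] \<open>c \<in> P\<close> by (simp add: cls_def)
  qed
  have ps_mem: "ps c d" if "P \<in> cls ` R" "c \<in> P" "d \<in> P" for P c d
    using rep[OF that(1,2)] that(3) by (simp add: cls_def)
  show False
  proof (rule no_friendship_graph_degree_ge_3[of "cls ` R" E])
    show "finite (cls ` R)" "cls ` R \<noteq> {}" using fin ne by auto
  next
    fix P Q assume PQ: "P \<in> cls ` R" "Q \<in> cls ` R" "E P Q"
    then obtain c where "c \<in> P" "\<phi> c \<in> Q" unfolding E_def by blast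
    moreover from this have "\<phi> (\<phi> c) = c" using invol sub[OF PQ(1)] by blast
    ultimately show "E Q P" unfolding E_def by metis
  next
    fix P assume "P \<in> cls ` R"
    then show "\<not> E P P" using ps_mem[of P] absolute sub[of P] unfolding E_def by blast
  next
    fix P Q assume PQ: "P \<in> cls ` R" "Q \<in> cls ` R" "P \<noteq> Q"
    then obtain c0 d0 where c0: "c0 \<in> R" "P = cls c0" and d0: "d0 \<in> R" "Q = cls d0" by blast
    have "\<not> ps c0 d0" using cls_eq c0 d0 PQ(3) by blast
    then obtain c d where c: "c \<in> R" and d: "d \<in> R" and "ps c0 c" and cd: "pt c d" and "ps d d0"
      using line c0 d0 by blast
    then have cP: "c \<in> P" and dQ: "d \<in> Q" using c0 d0 ps_sym by (auto simp: cls_def)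
    have ncd: "\<not> ps c d" using cls_eq[OF c d] rep[OF PQ(1) cP] rep[OF PQ(2) dQ] PQ(3) by blast
    \<comment> \<open>The flags \<open>c\<close> and \<open>d\<close> share the line joining
      \<open>P\<close> and \<open>Q\<close>, and \<open>cls (\<phi> c)\<close> is its pole.\<close>
    show "\<exists>!Z. Z \<in> cls ` R \<and> E P Z \<and> E Q Z"
    proof (rule ex1I[of _ "cls (\<phi> c)"])
      have "\<phi> d \<in> cls (\<phi> c)" using swap(2)[OF c d cd] closed[OF d] by (simp add: cls_def)
      then show "cls (\<phi> c) \<in> cls ` R \<and> E P (cls (\<phi> c)) \<and> E Q (cls (\<phi> c))"
        using closed[OF c] mem cP dQ unfolding E_def by blast
    next
      fix Z assume Z: "Z \<in> cls ` R \<and> E P Z \<and> E Q Z"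
      then obtain c' d' where c': "c' \<in> P" "\<phi> c' \<in> Z" and d': "d' \<in> Q" "\<phi> d' \<in> Z"
        unfolding E_def by blast
      have R: "c' \<in> R" "d' \<in> R" using c' d' sub PQ by blast+
      have "ps (\<phi> c') (\<phi> d')" using ps_mem Z c' d' by blast
      then have "pt c' d'" using swap(1)[of "\<phi> c'" "\<phi> d'"] closed R invol by simp
      moreover have "ps c c'" "ps d d'" using ps_mem PQ cP dQ c' d' by blast+
      ultimately have "c = c'" using line_unique[OF c R(1) d R(2)] cd ncd by blast
      then show "Z = cls (\<phi> c)" using rep[of Z "\<phi> c'"] Z c' by blast
    qed
  next
    fix P assume P: "P \<in> cls ` R"
    then obtain c0 where c0: "c0 \<in> R" "P = cls c0" by blast
    \<comment> \<open>Distinct lines through \<open>P\<close> have distinct poles, so the degree of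
      \<open>P\<close> is at least the number of lines through it.\<close>
    have "inj_on (\<lambda>c. cls (\<phi> c)) P"
    proof (rule inj_onI)
      fix c d assume cd: "c \<in> P" "d \<in> P" "cls (\<phi> c) = cls (\<phi> d)"
      have R: "c \<in> R" "d \<in> R" using cd sub[OF P] by blast+
      have "\<phi> d \<in> cls (\<phi> c)" using cd(3) mem closed R by blast
      then have "pt (\<phi> (\<phi> c)) (\<phi> (\<phi> d))" using swap(1) closed R by (simp add: cls_def)
      then show "c = d" using flag[OF R ps_mem[OF P cd(1,2)]] invol R by simp
    qed
    then have "card P = card ((\<lambda>c. cls (\<phi> c)) ` P)" by (simp add: card_image)
    also have "\<dots> \<le> card {Q \<in> cls ` R. E P Q}"
    proof (rule card_mono)
      show "finite {Q \<in> cls ` R. E P Q}" using fin by simp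
      show "(\<lambda>c. cls (\<phi> c)) ` P \<subseteq> {Q \<in> cls ` R. E P Q}"
        using sub[OF P] closed mem unfolding E_def by blast
    qed
    finally show "3 \<le> card {Q \<in> cls ` R. E P Q}" using thick[OF c0(1)] c0 by (simp add: cls_def)
  qed
qed

section \<open>The exchange condition\<close>

text \<open>For a word s_1 ... s_n these are the conjugates s_1 ... s_i ... s_1. Multiplying the
  product of the word on the left by the i-th of them deletes the letter s_i.\<close>

primrec reflections :: "('w, 'm) monoid_scheme \<Rightarrow> 'w list \<Rightarrow> 'w list" where
  "reflections W [] = []"
| "reflections W (s # u) = s # map (\<lambda>r. s \<otimes>\<^bsub>W\<^esub> r \<otimes>\<^bsub>W\<^esub> s) (reflections W u)"

lemma rev_in_lists_iff [simp]: "rev u \<in> lists A \<longleftrightarrow> u \<in> lists A"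
  by (simp add: in_lists_conv_set)

(* Otherwise auto unfolds word membership and the conditional rewrite rules no longer apply. *)
declare in_listsI [rule del] and in_listsD [rule del]

lemma word_prod_Nil [simp]: "word_prod W [] = \<one>\<^bsub>W\<^esub>"
  and word_prod_Cons [simp]: "word_prod W (s # u) = s \<otimes>\<^bsub>W\<^esub> word_prod W u"
  by (simp_all add: word_prod_def)

context coxeter_system
begin

abbreviation len :: "'a \<Rightarrow> nat" where "len \<equiv> cox_length W S"

lemma gen_closed [simp]: "s \<in> S \<Longrightarrow> s \<in> carrier W"
  using gens_in_carrier by blast

lemma gen_mult_self [simp]: "s \<in> S \<Longrightarrow> s \<otimes> s = \<one>"
  using pow_ord_eq_1[of s] gens_order_2[of s] by (simp add: numeral_2_eq_2)

lemma gen_neq_one: "s \<in> S \<Longrightarrow> s \<noteq> \<one>"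
  using gens_order_2[of s] by auto

lemma gen_inv [simp]: "s \<in> S \<Longrightarrow> inv s = s"
  by (rule inv_equality) auto

lemma gen_mult_cancel [simp]: "s \<in> S \<Longrightarrow> w \<in> carrier W \<Longrightarrow> s \<otimes> (s \<otimes> w) = w"
  by (simp flip: m_assoc)

lemma inv_mult_cancel [simp]:
  "a \<in> carrier W \<Longrightarrow> b \<in> carrier W \<Longrightarrow> inv a \<otimes> (a \<otimes> b) = b"
  "a \<in> carrier W \<Longrightarrow> b \<in> carrier W \<Longrightarrow> a \<otimes> (inv a \<otimes> b) = b"
  by (simp_all flip: m_assoc)

lemma word_prod_closed [simp]: "u \<in> lists S \<Longrightarrow> word_prod W u \<in> carrier W"
  by (induction u) auto

lemma word_prod_append [simp]:
  "u \<in> lists S \<Longrightarrow> v \<in> lists S \<Longrightarrow> word_prod W (u @ v) = word_prod W u \<otimes> word_prod W v"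
  by (induction u) (auto simp: m_assoc)

lemma word_prod_rev: "u \<in> lists S \<Longrightarrow> word_prod W (rev u) = inv (word_prod W u)"
  by (induction u) (auto simp: inv_mult_group)

lemma generate_eq_word_prods:
  assumes "J \<subseteq> S"
  shows "generate W J = word_prod W ` lists J"
proof (intro equalityI subsetI)
  fix w assume "w \<in> generate W J"
  then have "\<exists>u\<in>lists J. w = word_prod W u"
  proof (induction rule: generate.induct)
    case one
    show ?case by (rule bexI[of _ "[]"]) simp_all
  next
    case (incl h)
    then have "h \<in> S" using assms by blast
    then show ?case using incl by (intro bexI[of _ "[h]"]) simp_all
  next
    case (inv h)
    then have "h \<in> S" using assms by blast
    then show ?case using inv by (intro bexI[of _ "[h]"]) simp_all
  next
    case (eng h1 h2)
    then obtain u v where uv: "u \<in> lists J" "v \<in> lists J"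
      and h: "h1 = word_prod W u" "h2 = word_prod W v" by blast
    have "u \<in> lists S" "v \<in> lists S" using uv lists_mono[OF assms] by blast+
    then show ?case using uv h by (intro bexI[of _ "u @ v"]) simp_all
  qed
  then show "w \<in> word_prod W ` lists J" by blast
next
  fix w assume "w \<in> word_prod W ` lists J"
  then obtain u where "u \<in> lists J" "w = word_prod W u" by blast
  then show "w \<in> generate W J"
  proof (induction u arbitrary: w)
    case Nil
    then show ?case by (simp add: generate.one)
  next
    case (Cons s u)
    then show ?case by (simp add: generate.eng generate.incl)
  qed
qed

lemma parabolic_subgroup: "J \<subseteq> S \<Longrightarrow> subgroup (generate W J) W"
  using gens_in_carrier by (intro generate_is_subgroup) auto

lemma parabolic_closed: "J \<subseteq> S \<Longrightarrow> a \<in> generate W J \<Longrightarrow> a \<in> carrier W"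
  using parabolic_subgroup subgroup.mem_carrier by metis

section \<open>Parity of reflections in words\<close>

lemma reflections_closed: "u \<in> lists S \<Longrightarrow> set (reflections W u) \<subseteq> carrier W"
  by (induction u) auto

lemma reflections_append:
  "u \<in> lists S \<Longrightarrow> v \<in> lists S \<Longrightarrow>
   reflections W (u @ v) =
     reflections W u @ map (\<lambda>r. word_prod W u \<otimes> r \<otimes> inv (word_prod W u)) (reflections W v)"
proof (induction u)
  case Nil
  then show ?case using reflections_closed[of v] by (auto simp: subset_iff intro!: map_idI[symmetric])
next
  case (Cons s u)
  then show ?case using reflections_closed[of v]
    by (auto simp: subset_iff inv_mult_group m_assoc)
qed

lemma count_list_conj:
  assumes "g \<in> carrier W" "t \<in> carrier W" "set l \<subseteq> carrier W"
  shows "count_list (map (\<lambda>r. g \<otimes> r \<otimes> inv g) l) t = count_list l (inv g \<otimes> t \<otimes> g)"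
  using assms(3)
proof (induction l)
  case (Cons r l)
  have "g \<otimes> r \<otimes> inv g = t \<longleftrightarrow> r = inv g \<otimes> t \<otimes> g"
    using Cons assms by (auto simp: m_assoc)
  then show ?case using Cons by auto
qed auto

lemma count_reflections_append:
  assumes "u \<in> lists S" "v \<in> lists S" "t \<in> carrier W"
  shows "count_list (reflections W (u @ v)) t = count_list (reflections W u) t +
    count_list (reflections W v) (inv (word_prod W u) \<otimes> t \<otimes> word_prod W u)"
  using assms reflections_closed[of v] by (simp add: reflections_append count_list_conj)

lemma replicate_in_lists: "s \<in> S \<Longrightarrow> t \<in> S \<Longrightarrow> concat (replicate k [s, t]) \<in> lists S"
  by (induction k) auto

lemma word_prod_replicate:
  "s \<in> S \<Longrightarrow> t \<in> S \<Longrightarrow> word_prod W (concat (replicate k [s, t])) = (s \<otimes> t) [^] k"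
proof (induction k)
  case (Suc k)
  have "(s \<otimes> t) [^] Suc k = (s \<otimes> t) \<otimes> (s \<otimes> t) [^] k"
    using Suc.prems by (intro nat_pow_Suc2) auto
  then show ?case using Suc by (simp add: m_assoc)
qed auto

text \<open>Conjugation by \<open>s t\<close> raises the exponent by 2, since \<open>s\<close>
  inverts \<open>s t\<close>.\<close>

lemma reflections_replicate:
  assumes "s \<in> S" "t \<in> S"
  shows "reflections W (concat (replicate k [s, t])) = map (\<lambda>i. (s \<otimes> t) [^] i \<otimes> s) [0..<2 * k]"
proof (induction k)
  case (Suc k)
  have step: "(s \<otimes> t) \<otimes> ((s \<otimes> t) [^] i \<otimes> s) \<otimes> inv (s \<otimes> t) = (s \<otimes> t) [^] Suc (Suc i) \<otimes> s" for i
  proof -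
    have "(s \<otimes> t) [^] Suc (Suc i) \<otimes> s = (s \<otimes> t) \<otimes> (s \<otimes> t) [^] i \<otimes> (s \<otimes> t) \<otimes> s"
      using assms nat_pow_Suc2[of "s \<otimes> t" i] by simp
    then show ?thesis using assms by (simp add: inv_mult_group m_assoc)
  qed
  have "reflections W (concat (replicate (Suc k) [s, t])) =
    reflections W ([s, t] @ concat (replicate k [s, t]))" by simp
  also have "\<dots> = reflections W [s, t] @
      map (\<lambda>r. word_prod W [s, t] \<otimes> r \<otimes> inv (word_prod W [s, t])) (map (\<lambda>i. (s \<otimes> t) [^] i \<otimes> s) [0..<2 * k])"
    using assms replicate_in_lists by (subst reflections_append) (auto simp: Suc)
  also have "\<dots> = [s, s \<otimes> t \<otimes> s] @ map (\<lambda>i. (s \<otimes> t) [^] Suc (Suc i) \<otimes> s) [0..<2 * k]"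
    using assms step by (simp add: comp_def)
  also have "\<dots> = map (\<lambda>i. (s \<otimes> t) [^] i \<otimes> s) ([0, 1] @ map (\<lambda>i. Suc (Suc i)) [0..<2 * k])"
    using assms by (simp add: comp_def)
  also have "map (\<lambda>i. Suc (Suc i)) [0..<2 * k] = [Suc (Suc 0)..<Suc (Suc (2 * k))]"
  proof -
    have "map (\<lambda>i. Suc (Suc i)) [0..<2 * k] = map Suc (map Suc [0..<2 * k])" by simp
    then show ?thesis by (simp only: map_Suc_upt)
  qed
  also have "[0, 1] @ [Suc (Suc 0)..<Suc (Suc (2 * k))] = [0..<2 * Suc k]"
    by (simp add: upt_conv_Cons del: upt_Suc)
  finally show ?case .
qed auto

text \<open>The powers of \<open>s t\<close> have period \<open>ord (s \<otimes> t)\<close>, so the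
  second half of the list repeats the first. For infinite order the word is empty.\<close>

lemma even_count_relator:
  assumes "s \<in> S" "t \<in> S" "r \<in> carrier W"
  shows "even (count_list (reflections W (concat (replicate (ord (s \<otimes> t)) [s, t]))) r)"
proof -
  let ?m = "ord (s \<otimes> t)"
  have c: "s \<otimes> t \<in> carrier W" using assms by simp
  have per: "(s \<otimes> t) [^] (i + ?m) = (s \<otimes> t) [^] i" for i
    using c by (simp flip: nat_pow_mult)
  have "[0..<2 * ?m] = [0..<?m] @ map (\<lambda>i. i + ?m) [0..<?m]"
    using upt_add_eq_append[of 0 ?m ?m] by (simp add: map_add_upt mult_2)
  then show ?thesis
    using assms by (simp add: reflections_replicate comp_def per)
qed

text \<open>
  In a relator word every reflection occurs twice, so the parity of the number of its occurrences is an
  invariant of the group element; this replaces the usual action on roots.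
\<close>

lemma coxeter_rel_invariants:
  assumes "coxeter_rel W S u v"
  shows "u \<in> lists S \<and> v \<in> lists S \<and> word_prod W u = word_prod W v \<and>
    even (length u) = even (length v) \<and>
    (\<forall>r\<in>carrier W. even (count_list (reflections W u) r) = even (count_list (reflections W v) r))"
  using assms
proof (induction rule: coxeter_rel.induct)
  case (relator s t u v)
  let ?r = "concat (replicate (ord (s \<otimes> t)) [s, t])"
  have r: "?r \<in> lists S" "word_prod W ?r = \<one>"
    using relator replicate_in_lists word_prod_replicate by auto
  have "even (length (concat (replicate k [s, t])))" for k by (induction k) auto
  moreover have "even (count_list (reflections W (u @ ?r @ v)) t') = even (count_list (reflections W (u @ v)) t')"
    if "t' \<in> carrier W" for t'
    using that relator r even_count_relator[of s t "inv (word_prod W u) \<otimes> t' \<otimes> word_prod W u"]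
    by (simp add: count_reflections_append del: concat_append)
  ultimately show ?case using relator r by simp
qed auto

text \<open>This is where the presentation of \<open>W\<close> enters: equal products are connected
  by relators, so the parities depend on the group element alone.\<close>

lemma parity_invariants:
  assumes "u \<in> lists S" "v \<in> lists S" "word_prod W u = word_prod W v"
  shows "even (length u) = even (length v)"
    and "r \<in> carrier W \<Longrightarrow>
      even (count_list (reflections W u) r) = even (count_list (reflections W v) r)"
  using coxeter_rel_invariants[OF presentation[OF assms]] by auto

section \<open>Length, descents and exchange\<close>

lemma ex_reduced_word:
  assumes "w \<in> carrier W"
  obtains u where "u \<in> lists S" "length u = len w" "word_prod W u = w"
proof -
  have "w \<in> word_prod W ` lists S" using assms gens_generate generate_eq_word_prods[of S] by simp
  then have "\<exists>n. \<exists>u\<in>lists S. length u = n \<and> word_prod W u = w" by auto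
  then have "\<exists>u\<in>lists S. length u = len w \<and> word_prod W u = w"
    unfolding cox_length_def by (rule LeastI_ex)
  then show ?thesis using that by blast
qed

lemma len_le: "u \<in> lists S \<Longrightarrow> len (word_prod W u) \<le> length u"
  unfolding cox_length_def by (rule Least_le) auto

lemma len_one [simp]: "len \<one> = 0"
  using len_le[of "[]"] by simp

lemma len_eq_0_iff: "w \<in> carrier W \<Longrightarrow> len w = 0 \<longleftrightarrow> w = \<one>"
  using ex_reduced_word[of w] by (metis (no_types) len_one length_0_conv word_prod_Nil)

lemma len_mult_le: "x \<in> carrier W \<Longrightarrow> y \<in> carrier W \<Longrightarrow> len (x \<otimes> y) \<le> len x + len y"
proof -
  assume x: "x \<in> carrier W" and y: "y \<in> carrier W"
  obtain u where "u \<in> lists S" "length u = len x" "word_prod W u = x"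
    using ex_reduced_word[OF x] .
  moreover obtain v where "v \<in> lists S" "length v = len y" "word_prod W v = y"
    using ex_reduced_word[OF y] .
  ultimately show ?thesis using len_le[of "u @ v"] by simp
qed

lemma len_gen [simp]: "s \<in> S \<Longrightarrow> len s = 1"
  using len_le[of "[s]"] len_eq_0_iff[of s] gen_neq_one[of s] by fastforce

lemma len_inv [simp]: "w \<in> carrier W \<Longrightarrow> len (inv w) = len w"
proof -
  have le: "len (inv x) \<le> len x" if x: "x \<in> carrier W" for x
  proof -
    obtain u where "u \<in> lists S" "length u = len x" "word_prod W u = x"
      using ex_reduced_word[OF x] .
    then show ?thesis using len_le[of "rev u"] word_prod_rev[of u] by simp
  qed
  assume "w \<in> carrier W"
  then show ?thesis using le[of w] le[of "inv w"] by simp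
qed

lemma even_len_gen_mult:
  assumes "s \<in> S" "w \<in> carrier W"
  shows "even (len (s \<otimes> w)) \<longleftrightarrow> odd (len w)"
proof -
  obtain u where u: "u \<in> lists S" "length u = len w" "word_prod W u = w"
    using ex_reduced_word[OF assms(2)] .
  obtain v where v: "v \<in> lists S" "length v = len (s \<otimes> w)" "word_prod W v = s \<otimes> w"
    using ex_reduced_word[of "s \<otimes> w"] assms by auto
  show ?thesis using parity_invariants(1)[of "s # u" v] u v assms by simp
qed

lemma len_gen_mult_cases:
  assumes "s \<in> S" "w \<in> carrier W"
  shows "len (s \<otimes> w) = len w + 1 \<or> len w = len (s \<otimes> w) + 1"
proof -
  have "len (s \<otimes> w) \<le> 1 + len w" using len_mult_le[of s w] assms by simp
  moreover have "len w \<le> 1 + len (s \<otimes> w)" using len_mult_le[of s "s \<otimes> w"] assms by simp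
  moreover have "len (s \<otimes> w) \<noteq> len w" using even_len_gen_mult[OF assms] by auto
  ultimately show ?thesis by linarith
qed

lemma ex_descent:
  assumes "w \<in> carrier W" "w \<noteq> \<one>"
  obtains s where "s \<in> S" "len w = len (s \<otimes> w) + 1"
proof -
  obtain u where u: "u \<in> lists S" "length u = len w" "word_prod W u = w"
    using ex_reduced_word[OF assms(1)] .
  then obtain s v where e: "u = s # v" using assms(2) by (cases u) auto
  then have "len (s \<otimes> w) \<le> length v" using u len_le[of v] by auto
  then show ?thesis using that[of s] len_gen_mult_cases[of s w] u e assms(1) by auto
qed

text \<open>The first reflection cancels the first letter. For any other one, conjugation by the
  first letter moves the cancellation into the tail.\<close>

lemma reflection_deletes:
  assumes "u \<in> lists S" "r \<in> set (reflections W u)"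
  shows "r \<in> carrier W \<and> len (r \<otimes> word_prod W u) < length u"
proof -
  have "\<exists>v\<in>lists S. length v < length u \<and> r \<otimes> word_prod W u = word_prod W v"
    using assms
  proof (induction u arbitrary: r)
    case (Cons s u)
    show ?case
    proof (cases "r = s")
      case True
      then show ?thesis using Cons.hyps by (intro bexI[of _ u]) auto
    next
      case False
      then obtain r' where r': "r' \<in> set (reflections W u)" "r = s \<otimes> r' \<otimes> s"
        using Cons.prems by auto
      then obtain v where v: "v \<in> lists S" "length v < length u" "r' \<otimes> word_prod W u = word_prod W v"
        using Cons by auto
      have "r' \<in> carrier W" using r' Cons.hyps reflections_closed[of u] by auto
      then show ?thesis using r' v Cons.hyps
        by (intro bexI[of _ "s # v"]) (auto simp: m_assoc)
    qed
  qed auto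
  then show ?thesis using reflections_closed[of u] assms len_le by fastforce
qed

text \<open>If the first letter \<open>s\<close> recurred as a later reflection
  \<open>s r s\<close>, then \<open>r = s\<close> would be a reflection of the tail and deleting a
  letter of the tail would shorten the whole product.\<close>

lemma distinct_reflections:
  "u \<in> lists S \<Longrightarrow> len (word_prod W u) = length u \<Longrightarrow> distinct (reflections W u)"
proof (induction u)
  case (Cons s u)
  have u: "u \<in> lists S" "s \<in> S" using Cons.prems by auto
  have "len (s \<otimes> word_prod W u) \<le> 1 + len (word_prod W u)"
    using len_mult_le[of s "word_prod W u"] u by simp
  then have red: "len (word_prod W u) = length u" using Cons.prems len_le[of u] by simp
  have "s \<notin> (\<lambda>r. s \<otimes> r \<otimes> s) ` set (reflections W u)"
  proof
    assume "s \<in> (\<lambda>r. s \<otimes> r \<otimes> s) ` set (reflections W u)"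
    then obtain r where r: "r \<in> set (reflections W u)" "s = s \<otimes> r \<otimes> s" by auto
    have rc: "r \<in> carrier W" using r reflections_closed u by blast
    have "s \<otimes> s \<otimes> s = s \<otimes> (s \<otimes> r \<otimes> s) \<otimes> s" using r by simp
    then have "r = s" using u rc by (simp add: m_assoc)
    then show False using reflection_deletes[OF u(1) r(1)] Cons.prems by simp
  qed
  moreover have "inj_on (\<lambda>r. s \<otimes> r \<otimes> s) (set (reflections W u))"
    using reflections_closed[OF u(1)] u by (auto intro!: inj_onI simp: subset_iff)
  ultimately show ?case using Cons.IH red u by (simp add: distinct_map)
qed auto

text \<open>Prefixing \<open>s\<close> to a reduced word of \<open>s w\<close> gives a reduced word
  of \<open>w\<close> in which the reflection \<open>s\<close> occurs exactly once. By parity it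
  occurs an odd number of times in every word of \<open>w\<close>, reduced or not.\<close>

lemma descent_in_reflections:
  assumes "s \<in> S" "u \<in> lists S" "len (s \<otimes> word_prod W u) < len (word_prod W u)"
  shows "s \<in> set (reflections W u)"
proof -
  obtain v where v: "v \<in> lists S" "length v = len (s \<otimes> word_prod W u)" "word_prod W v = s \<otimes> word_prod W u"
    using ex_reduced_word[of "s \<otimes> word_prod W u"] assms by auto
  have w: "word_prod W (s # v) = word_prod W u" using v assms by simp
  have sv: "s # v \<in> lists S" using v assms by simp
  have "len (word_prod W (s # v)) = length (s # v)"
    using len_le[OF sv] w v(2) assms(3) by simp
  then have "distinct (reflections W (s # v))" by (rule distinct_reflections[OF sv])
  then have "count_list (reflections W (s # v)) s = 1" by (simp add: count_list_0_iff)
  then have "odd (count_list (reflections W u) s)"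
    using parity_invariants(2)[OF sv assms(2) w, of s] assms(1) by simp
  then show ?thesis by (metis count_notin even_zero)
qed

text \<open>Concatenate reduced words of \<open>P\<close> and \<open>Q\<close>. The reflection
  \<open>s\<close> belongs to the first word, or is the conjugate by \<open>P\<close> of a
  reflection \<open>r\<close> of the second. The concatenation need not be reduced, and
  \<open>r\<close> need not be a generator.\<close>

lemma exchange:
  assumes s: "s \<in> S" and P: "P \<in> carrier W" and Q: "Q \<in> carrier W"
    and desc: "len (s \<otimes> (P \<otimes> Q)) < len (P \<otimes> Q)"
  shows "len (s \<otimes> P) < len P \<or> (\<exists>r\<in>carrier W. s \<otimes> P = P \<otimes> r \<and> len (r \<otimes> Q) < len Q)"
proof -
  obtain u where u: "u \<in> lists S" "length u = len P" "word_prod W u = P" using ex_reduced_word[OF P] .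
  obtain v where v: "v \<in> lists S" "length v = len Q" "word_prod W v = Q" using ex_reduced_word[OF Q] .
  have "s \<in> set (reflections W (u @ v))"
    using descent_in_reflections[of s "u @ v"] s u v desc by simp
  then consider "s \<in> set (reflections W u)"
    | r where "r \<in> set (reflections W v)" "s = P \<otimes> r \<otimes> inv P"
    using u v by (auto simp: reflections_append)
  then show ?thesis
  proof cases
    case 1
    then show ?thesis using reflection_deletes[OF u(1) 1] u by simp
  next
    case 2
    have "r \<in> carrier W" "len (r \<otimes> Q) < len Q" using reflection_deletes[OF v(1) 2(1)] v by auto
    moreover from this have "s \<otimes> P = P \<otimes> r" using 2(2) P by (simp add: m_assoc)
    ultimately show ?thesis by blast
  qed
qed

text \<open>In other words, any reduced word of \<open>u\<close> extends to one of \<open>w\<close>.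
  Write \<open>u = s v\<close> with \<open>v\<close> shorter and apply exchange to
  \<open>w = v (inv v w)\<close>: \<open>s\<close> does not shorten \<open>v\<close>, so the second
  factor becomes shorter.\<close>

lemma len_complement:
  assumes w: "w \<in> carrier W" and all: "\<And>s. s \<in> S \<Longrightarrow> len (s \<otimes> w) < len w"
    and "u \<in> carrier W"
  shows "len w = len u + len (inv u \<otimes> w)"
  using assms(3)
proof (induction "len u" arbitrary: u rule: less_induct)
  case less
  show ?case
  proof (cases "u = \<one>")
    case True
    then show ?thesis using w by simp
  next
    case False
    then obtain s where s: "s \<in> S" "len u = len (s \<otimes> u) + 1" using ex_descent less.prems by metis
    define v where "v = s \<otimes> u"
    have v: "v \<in> carrier W" "u = s \<otimes> v" "len v < len u" using s less.prems by (auto simp: v_def)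
    have IH: "len w = len v + len (inv v \<otimes> w)" using less v by simp
    have vw: "v \<otimes> (inv v \<otimes> w) = w" using v w by (simp add: m_assoc)
    have uw: "inv u \<otimes> w = inv v \<otimes> (s \<otimes> w)" using v s w by (simp add: inv_mult_group m_assoc)
    have "len (s \<otimes> (v \<otimes> (inv v \<otimes> w))) < len (v \<otimes> (inv v \<otimes> w))"
      using all[OF s(1)] vw by simp
    then have "len (s \<otimes> v) < len v \<or>
      (\<exists>r\<in>carrier W. s \<otimes> v = v \<otimes> r \<and> len (r \<otimes> (inv v \<otimes> w)) < len (inv v \<otimes> w))"
      using exchange[of s v "inv v \<otimes> w"] s v w by simp
    then obtain r where r: "r \<in> carrier W" "s \<otimes> v = v \<otimes> r" "len (r \<otimes> (inv v \<otimes> w)) < len (inv v \<otimes> w)"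
      using v by auto
    have "s \<otimes> w = s \<otimes> v \<otimes> (inv v \<otimes> w)" using vw s v w by (simp add: m_assoc)
    also have "\<dots> = v \<otimes> (r \<otimes> (inv v \<otimes> w))" using r v w by (simp add: m_assoc)
    finally have "s \<otimes> w = v \<otimes> (r \<otimes> (inv v \<otimes> w))" .
    then have "inv v \<otimes> (s \<otimes> w) = r \<otimes> (inv v \<otimes> w)" using r(1) v(1) w by simp
    then have "len u + len (inv u \<otimes> w) \<le> len w"
      using r IH uw s(2) v_def by simp
    moreover have "len w \<le> len u + len (inv u \<otimes> w)"
      using len_mult_le[of u "inv u \<otimes> w"] less.prems w by (simp add: m_assoc)
    ultimately show ?thesis by simp
  qed
qed

text \<open>By \<open>len_complement\<close>, an element shortened by all generators is at least as
  long as every \<open>u\<close>. This makes being longest a local condition.\<close>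

lemma longest_iff_all_descents:
  assumes "w \<in> carrier W"
  shows "longest_element W S w \<longleftrightarrow> (\<forall>s\<in>S. len (s \<otimes> w) < len w)"
proof
  assume L: "longest_element W S w"
  show "\<forall>s\<in>S. len (s \<otimes> w) < len w"
  proof
    fix s assume s: "s \<in> S"
    then have "s \<otimes> w \<in> carrier W" using assms by simp
    then have "len (s \<otimes> w) \<le> len w"
      using L unfolding longest_element_def is_arg_max_def by (meson leI)
    then show "len (s \<otimes> w) < len w" using len_gen_mult_cases[OF s assms] by auto
  qed
next
  assume all: "\<forall>s\<in>S. len (s \<otimes> w) < len w"
  have "len u \<le> len w" if "u \<in> carrier W" for u
    using len_complement[OF assms _ that] all by simp
  then show "longest_element W S w"
    using assms unfolding longest_element_def is_arg_max_def by (simp add: not_less)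
qed

lemma longest_unique:
  assumes "longest_element W S w" "longest_element W S w'"
  shows "w = w'"
proof -
  have c: "w \<in> carrier W" "w' \<in> carrier W"
    using assms by (auto simp: longest_element_def is_arg_max_def)
  have "len w' \<le> len w" "len w \<le> len w'"
    using assms c unfolding longest_element_def is_arg_max_def by (meson leI)+
  moreover have "len w = len w' + len (inv w' \<otimes> w)"
    using len_complement[OF c(1) _ c(2)] longest_iff_all_descents[OF c(1)] assms by simp
  ultimately have "inv w' \<otimes> w = \<one>" using len_eq_0_iff[of "inv w' \<otimes> w"] c by simp
  then have "w' \<otimes> (inv w' \<otimes> w) = w'" using c by simp
  then show ?thesis using c by simp
qed

text \<open>Build \<open>a\<close> letter by letter. If a new letter \<open>s\<close> shortened
  \<open>b v\<close> without shortening \<open>b\<close>, exchange would give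
  \<open>r = inv b s b\<close> in the parabolic subgroup with \<open>r v\<close> shorter than
  \<open>v\<close>, against minimality.\<close>

lemma len_mult_coset_minimal:
  assumes J: "J \<subseteq> S" and v: "v \<in> carrier W" and min: "\<And>b. b \<in> generate W J \<Longrightarrow> len v \<le> len (b \<otimes> v)"
    and a: "a \<in> generate W J"
  shows "len (a \<otimes> v) = len a + len v"
proof -
  obtain u where "u \<in> lists J" "a = word_prod W u" using a generate_eq_word_prods[OF J] by auto
  then show ?thesis
  proof (induction u arbitrary: a)
    case Nil
    then show ?case using v by simp
  next
    case (Cons s u)
    define b where "b = word_prod W u"
    have s: "s \<in> S" "s \<in> J" and u: "u \<in> lists J" using Cons.hyps J by auto
    have bJ: "b \<in> generate W J" using u generate_eq_word_prods[OF J] b_def by auto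
    have b: "b \<in> carrier W" using bJ J parabolic_closed by blast
    have IH: "len (b \<otimes> v) = len b + len v" using Cons.IH[OF b_def] .
    have a: "a = s \<otimes> b" using Cons.prems b_def by simp
    have step: "len (s \<otimes> (b \<otimes> v)) = len (b \<otimes> v) + 1 \<or> len (b \<otimes> v) = len (s \<otimes> (b \<otimes> v)) + 1"
      using len_gen_mult_cases[of s "b \<otimes> v"] s b v by simp
    show ?case
    proof (cases "len (s \<otimes> b) < len b")
      case True
      then have "len b = len (s \<otimes> b) + 1" using len_gen_mult_cases[OF s(1) b] by auto
      moreover have "len (s \<otimes> b \<otimes> v) \<le> len (s \<otimes> b) + len v" using len_mult_le s b v by simp
      ultimately show ?thesis using step IH a s b v by (simp add: m_assoc)
    next
      case False
      have "\<not> len (s \<otimes> (b \<otimes> v)) < len (b \<otimes> v)"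
      proof
        assume "len (s \<otimes> (b \<otimes> v)) < len (b \<otimes> v)"
        then obtain r where r: "r \<in> carrier W" "s \<otimes> b = b \<otimes> r" "len (r \<otimes> v) < len v"
          using exchange[OF s(1) b v] False by auto
        have "r = inv b \<otimes> (s \<otimes> b)" using r(1,2) b by simp
        moreover have "inv b \<otimes> (s \<otimes> b) \<in> generate W J"
          using parabolic_subgroup[OF J] bJ s(2)
          by (intro subgroup.m_closed subgroup.m_inv_closed) (auto intro: generate.incl)
        ultimately show False using min[of r] r by simp
      qed
      then show ?thesis
        using step IH a s b v False len_gen_mult_cases[OF s(1) b] by (simp add: m_assoc)
    qed
  qed
qed

lemma ex_parabolic_factorization:
  assumes J: "J \<subseteq> S" and w: "w \<in> carrier W"
  obtains a v where "a \<in> generate W J" "v \<in> carrier W" "w = a \<otimes> v"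
    and "\<And>b. b \<in> generate W J \<Longrightarrow> len (b \<otimes> v) = len b + len v"
proof -
  \<comment> \<open>\<open>b w\<close> is a shortest element of the coset of \<open>w\<close>; it
    serves as \<open>v\<close>, and \<open>inv b\<close> as \<open>a\<close>.\<close>
  define b where "b = arg_min (\<lambda>b. len (b \<otimes> w)) (\<lambda>b. b \<in> generate W J)"
  have "\<one> \<in> generate W J" by (rule generate.one)
  then have b: "b \<in> generate W J" and min: "\<And>c. c \<in> generate W J \<Longrightarrow> len (b \<otimes> w) \<le> len (c \<otimes> w)"
    using arg_min_natI[of "\<lambda>b. b \<in> generate W J" \<one> "\<lambda>b. len (b \<otimes> w)"]
      arg_min_nat_le[of "\<lambda>b. b \<in> generate W J" _ "\<lambda>b. len (b \<otimes> w)"] by (auto simp: b_def)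
  have bc: "b \<in> carrier W" using b J parabolic_closed by blast
  have sub: "subgroup (generate W J) W" using parabolic_subgroup[OF J] .
  have "len (b \<otimes> w) \<le> len (c \<otimes> (b \<otimes> w))" if "c \<in> generate W J" for c
    using min[of "c \<otimes> b"] that b bc w parabolic_closed[OF J that] subgroup.m_closed[OF sub]
    by (simp add: m_assoc)
  then have "len (c \<otimes> (b \<otimes> w)) = len c + len (b \<otimes> w)" if "c \<in> generate W J" for c
    using len_mult_coset_minimal[OF J _ _ that, of "b \<otimes> w"] bc w by simp
  moreover have "w = inv b \<otimes> (b \<otimes> w)" using bc w by (simp add: m_assoc)
  ultimately show ?thesis
    using that[of "inv b" "b \<otimes> w"] b bc w subgroup.m_inv_closed[OF sub] by simp
qed

text \<open>Put \<open>u = s w\<close>. Then \<open>s\<close> lengthens \<open>u\<close> but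
  shortens \<open>u r\<close>, so exchange yields \<open>s u = u q\<close> with \<open>q r\<close>
  shorter than the generator \<open>r\<close>, that is, \<open>q = r\<close>.\<close>

lemma commute_of_len:
  assumes s: "s \<in> S" and r: "r \<in> S" and w: "w \<in> carrier W"
    and "len (s \<otimes> w) < len w" "len (w \<otimes> r) < len w" "len w \<le> len (s \<otimes> w \<otimes> r)"
  shows "s \<otimes> w = w \<otimes> r"
proof -
  define u where "u = s \<otimes> w"
  have u: "u \<in> carrier W" and w_eq: "w = s \<otimes> u" using s w by (auto simp: u_def)
  have "s \<otimes> (u \<otimes> r) = s \<otimes> u \<otimes> r" using s r u by (simp add: m_assoc)
  then have "len (s \<otimes> (u \<otimes> r)) < len w" using assms(5) by (simp flip: w_eq)
  moreover have "len w \<le> len (u \<otimes> r)" using assms(6) by (simp only: u_def)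
  ultimately have "len (s \<otimes> (u \<otimes> r)) < len (u \<otimes> r)" by simp
  moreover have "\<not> len (s \<otimes> u) < len u" using assms(4) by (simp flip: w_eq u_def)
  ultimately obtain q where q: "q \<in> carrier W" "s \<otimes> u = u \<otimes> q" "len (q \<otimes> r) < len r"
    using exchange[OF s u, of r] r by auto
  then have "q \<otimes> r = \<one>" using r len_eq_0_iff[of "q \<otimes> r"] by simp
  then have "q \<otimes> r \<otimes> r = r" using r by simp
  then have "q = r" using q(1) r by (simp add: m_assoc)
  then have "w = u \<otimes> r" using q(2) w_eq by simp
  then have "w \<otimes> r = u" using r u by (simp add: m_assoc)
  then show ?thesis by (simp add: u_def)
qed

end

section \<open>Bonds of finite Coxeter groups\<close>

primrec alternating :: "'w \<Rightarrow> 'w \<Rightarrow> nat \<Rightarrow> 'w list" where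
  "alternating x z 0 = []"
| "alternating x z (Suc n) = x # alternating z x n"

lemma alternating_in_lists: "x \<in> A \<Longrightarrow> z \<in> A \<Longrightarrow> alternating x z n \<in> lists A"
  by (induction n arbitrary: x z) auto

lemma length_alternating [simp]: "length (alternating x z n) = n"
  by (induction n arbitrary: x z) auto

context coxeter_system
begin

lemma gen_mult_pow: "x \<in> S \<Longrightarrow> z \<in> S \<Longrightarrow> z \<otimes> (x \<otimes> z) [^] (k::nat) = (z \<otimes> x) [^] k \<otimes> z"
proof (induction k)
  case (Suc k)
  have "z \<otimes> (x \<otimes> z) [^] Suc k = z \<otimes> (x \<otimes> z) [^] k \<otimes> (x \<otimes> z)" using Suc.prems by (simp add: m_assoc)
  also have "\<dots> = (z \<otimes> x) [^] k \<otimes> z \<otimes> (x \<otimes> z)" using Suc by simp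
  finally show ?case using Suc.prems by (simp add: m_assoc)
qed simp

lemma reflections_alternating:
  assumes "x \<in> S" "z \<in> S" "r \<in> set (reflections W (alternating z x n))"
  shows "\<exists>i<n. r = (z \<otimes> x) [^] i \<otimes> z"
  using assms
proof (induction n arbitrary: x z r)
  case (Suc n)
  show ?case
  proof (cases "r = z")
    case True
    then show ?thesis using Suc.prems by (intro exI[of _ 0]) simp
  next
    case False
    then obtain r' where r': "r' \<in> set (reflections W (alternating x z n))" "r = z \<otimes> r' \<otimes> z"
      using Suc.prems by auto
    then obtain i where i: "i < n" "r' = (x \<otimes> z) [^] i \<otimes> x" using Suc by blast
    have "r = z \<otimes> (x \<otimes> z) [^] Suc i" using i r' Suc.prems by (simp add: m_assoc)
    then have "r = (z \<otimes> x) [^] Suc i \<otimes> z" using gen_mult_pow[of x z "Suc i"] Suc.prems(1,2) by metis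
    then show ?thesis using i by blast
  qed
qed simp

text \<open>Inductively \<open>w\<close> starts with the alternating word \<open>A\<close> whose
  first letter is \<open>z\<close>. If \<open>x\<close> shortened \<open>A\<close>, then
  \<open>x = (z x)^i z\<close> for some \<open>i < n\<close>, so \<open>(z x)^(i + 1) = 1\<close>
  with an exponent below the order. Hence exchange shortens the remainder instead, and
  \<open>x\<close> can be put in front of \<open>A\<close>.\<close>

lemma alternating_prefix:
  assumes "x \<in> S" "z \<in> S" "w \<in> carrier W" "len (x \<otimes> w) < len w" "len (z \<otimes> w) < len w"
    and "n \<le> ord (x \<otimes> z)"
  shows "\<exists>v\<in>carrier W. w = word_prod W (alternating x z n) \<otimes> v \<and> len w = n + len v"
  using assms
proof (induction n arbitrary: x z)
  case 0
  then show ?case by (intro bexI[of _ w]) auto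
next
  case (Suc n)
  note xz = Suc.prems(1,2)
  have inv_eq: "z \<otimes> x = inv (x \<otimes> z)" using xz by (simp add: inv_mult_group)
  have ord_eq: "ord (z \<otimes> x) = ord (x \<otimes> z)" unfolding inv_eq using xz by (simp add: ord_inv)
  define A where "A = word_prod W (alternating z x n)"
  have alt: "alternating z x n \<in> lists S" using alternating_in_lists[OF xz(2,1)] .
  have A: "A \<in> carrier W" using alt by (simp add: A_def)
  obtain v where v: "v \<in> carrier W" "w = A \<otimes> v" "len w = n + len v"
    using Suc.IH[OF xz(2,1) Suc.prems(3,5,4)] Suc.prems(6) unfolding ord_eq A_def by force
  have "\<not> len (x \<otimes> A) < len A"
  proof
    assume "len (x \<otimes> A) < len A"
    then have "x \<in> set (reflections W (alternating z x n))"
      using descent_in_reflections[OF xz(1) alt] by (simp add: A_def)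
    then obtain i where i: "i < n" "x = (z \<otimes> x) [^] i \<otimes> z"
      using reflections_alternating[OF xz] by blast
    have "(z \<otimes> x) [^] Suc i = (z \<otimes> x) [^] i \<otimes> z \<otimes> x" using xz by (simp add: m_assoc)
    also have "\<dots> = x \<otimes> x" by (simp flip: i(2))
    finally have "(z \<otimes> x) [^] Suc i = \<one>" using xz by simp
    then have "ord (z \<otimes> x) dvd Suc i" using xz by (intro iffD1[OF pow_eq_id]) simp_all
    then have "ord (z \<otimes> x) \<le> Suc i" by (rule dvd_imp_le) simp
    then show False using i(1) ord_eq Suc.prems(6) by simp
  qed
  then obtain r where r: "r \<in> carrier W" "x \<otimes> A = A \<otimes> r" "len (r \<otimes> v) < len v"
    using exchange[OF xz(1) A v(1)] Suc.prems(4) unfolding v(2) by blast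
  have "w = x \<otimes> (x \<otimes> A \<otimes> v)" using xz A v(1,2) by (simp add: m_assoc)
  also have "\<dots> = x \<otimes> (A \<otimes> r \<otimes> v)" by (simp only: r(2))
  also have "\<dots> = x \<otimes> A \<otimes> (r \<otimes> v)" using xz A v(1) r(1) by (simp add: m_assoc)
  finally have w: "w = word_prod W (alternating x z (Suc n)) \<otimes> (r \<otimes> v)" by (simp add: A_def)
  have "alternating x z (Suc n) \<in> lists S" using xz alt by simp
  then have "len w \<le> Suc n + len (r \<otimes> v)"
    using len_mult_le[of "word_prod W (alternating x z (Suc n))" "r \<otimes> v"] len_le[of "alternating x z (Suc n)"]
      r(1) v(1) unfolding w[symmetric] by simp
  then have "len w = Suc n + len (r \<otimes> v)" using r(3) v(3) by simp
  then show ?case using w r(1) v(1) m_closed by blast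
qed

lemma ord_gens_ge_2:
  assumes "finite (carrier W)" "x \<in> S" "z \<in> S" "x \<noteq> z"
  shows "2 \<le> ord (x \<otimes> z)"
proof -
  have "ord (x \<otimes> z) \<noteq> 0" using finite_cyclic_subgroup assms
    by (metis gen_closed m_closed ord_ge_1 not_one_le_zero)
  moreover have "ord (x \<otimes> z) \<noteq> 1"
  proof
    assume "ord (x \<otimes> z) = 1"
    then have "x \<otimes> z = \<one>" using pow_ord_eq_1[of "x \<otimes> z"] assms by simp
    then have "x \<otimes> (x \<otimes> z) = x" using assms by simp
    then show False using assms by simp
  qed
  ultimately show ?thesis by linarith
qed

text \<open>No braid move applies to the periodic word \<open>\<dots>utstutst\<close> when \<open>s t\<close> and \<open>t u\<close> have order at
  least 4, so all its suffixes are reduced.\<close>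

lemma no_consecutive_bonds_ge_4:
  assumes fin: "finite (carrier W)" and S: "s \<in> S" "t \<in> S" "u \<in> S"
    and dist: "s \<noteq> t" "t \<noteq> u" "s \<noteq> u" and ord4: "4 \<le> ord (s \<otimes> t)" "4 \<le> ord (t \<otimes> u)"
  shows False
proof -
  \<comment> \<open>Read from the right, the infinite word is t, s, t, u, repeated with period 4;
    \<open>g k\<close> is the product of its \<open>k\<close> rightmost letters.\<close>
  define letter where "letter k = (if even k then t else if k mod 4 = 1 then s else u)" for k :: nat
  define g where "g = rec_nat \<one> (\<lambda>k x. letter k \<otimes> x)"
  have g0: "g 0 = \<one>" and gS: "\<And>k. g (Suc k) = letter k \<otimes> g k" by (simp_all add: g_def)
  have letter: "letter k \<in> S" "letter k \<in> {s, t, u}" for k using S by (auto simp: letter_def)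
  have g: "g k \<in> carrier W" for k using letter by (induction k) (auto simp: g0 gS)
  have g_cancel: "letter k \<otimes> g (Suc k) = g k" for k using letter g by (simp add: gS)
  have neq: "letter (Suc k) \<noteq> letter k" for k using dist by (auto simp: letter_def)
  have sym: "ord (y \<otimes> x) = ord (x \<otimes> y)" if "x \<in> S" "y \<in> S" for x y
  proof -
    have "y \<otimes> x = inv (x \<otimes> y)" using that by (simp add: inv_mult_group)
    then show ?thesis using that by (simp add: ord_inv)
  qed
  have ord_letter: "4 \<le> ord (letter (Suc k) \<otimes> letter k)" for k
    using ord4 sym S by (auto simp: letter_def)
  \<comment> \<open>No four consecutive letters have the form \<open>x z x z\<close>.\<close>
  have nonperiodic: "\<not> (letter (k + 3) = letter (k + 1) \<and> letter (k + 2) = letter k)" for k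
  proof (cases "even k")
    case True
    then have "(k + 3) mod 4 = 1 \<longleftrightarrow> (k + 1) mod 4 \<noteq> 1" by presburger
    then show ?thesis using True dist by (auto simp: letter_def)
  next
    case False
    then have "(k + 2) mod 4 = 1 \<longleftrightarrow> k mod 4 \<noteq> 1" by presburger
    then show ?thesis using False dist by (auto simp: letter_def)
  qed
  \<comment> \<open>The induction also needs that, among the three generators, only the leading
    letter can be a left descent.\<close>
  have main: "len (g k) = k \<and>
    (\<forall>z\<in>{s, t, u}. len (z \<otimes> g k) < len (g k) \<longrightarrow> (\<exists>j. k = Suc j \<and> z = letter j))" for k
  proof (induction k rule: less_induct)
    case (less k)
    have desc: "\<exists>i. j = Suc i \<and> z = letter i" if "j < k" "z \<in> {s, t, u}" "len (z \<otimes> g j) < j" for j z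
      using less[OF that(1)] that by auto
    show ?case
    proof (cases k)
      case 0
      then show ?thesis using S by (auto simp: g0)
    next
      case (Suc j)
      have lenj: "len (g j) = j" using less Suc by simp
      define x where "x = letter j"
      have x: "x \<in> S" "x \<in> {s, t, u}" using letter by (simp_all add: x_def)
      have xg: "x \<otimes> g k = g j" using Suc g_cancel by (simp add: x_def)
      have "\<not> len (x \<otimes> g j) < j" using desc[of j x] Suc x neq by (auto simp: x_def)
      then have lenk: "len (g k) = k"
        using len_gen_mult_cases[OF x(1) g[of j]] lenj Suc gS by (simp add: x_def)
      \<comment> \<open>A second descent \<open>z\<close> makes \<open>g k\<close> start with
        \<open>x z\<close>, and by induction \<open>z\<close> is the next letter of the word. So
        \<open>x\<close> and \<open>z\<close> are neighbouring letters, their product has order at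
        least 4, and \<open>g k\<close> starts with \<open>x z x z\<close>. Stripping these factors
        shows that the word itself has four alternating letters.\<close>
      have "z = x" if z: "z \<in> {s, t, u}" "len (z \<otimes> g k) < len (g k)" for z
      proof (rule ccontr)
        assume "z \<noteq> x"
        have zS: "z \<in> S" using z S by auto
        have xdesc: "len (x \<otimes> g k) < len (g k)" using xg lenj lenk Suc by simp
        note prefix = alternating_prefix[OF x(1) zS g[of k] xdesc z(2)]
        obtain v where v: "v \<in> carrier W" "g k = x \<otimes> (z \<otimes> v)" "k = 2 + len v"
          using prefix[of 2] ord_gens_ge_2[OF fin x(1) zS] \<open>z \<noteq> x\<close> x zS lenk
          by (auto simp: numeral_2_eq_2 m_assoc)
        have "z \<otimes> g j = v" using xg[symmetric] v x zS by simp
        then obtain i where i: "j = Suc i" "z = letter i" using desc[of j z] z v Suc by auto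
        have "4 \<le> ord (x \<otimes> z)" using ord_letter i by (simp add: x_def)
        then obtain v' where v': "v' \<in> carrier W" "g k = x \<otimes> (z \<otimes> (x \<otimes> (z \<otimes> v')))" "k = 4 + len v'"
          using prefix[of 4] x zS lenk by (auto simp: eval_nat_numeral m_assoc)
        have gi: "g i = x \<otimes> (z \<otimes> v')"
        proof -
          have "g j = z \<otimes> (x \<otimes> (z \<otimes> v'))" using xg[symmetric] v' x zS by simp
          then have "z \<otimes> g j = x \<otimes> (z \<otimes> v')" using v' x zS by simp
          then show ?thesis using i g_cancel by simp
        qed
        then have "x \<otimes> g i = z \<otimes> v'" using x zS v' by simp
        moreover have "len (z \<otimes> v') \<le> 1 + len v'" using len_mult_le[of z v'] zS v' by simp
        ultimately obtain h where h: "i = Suc h" "x = letter h"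
          using desc[of i x] x v' i Suc by auto
        have "g h = z \<otimes> v'" using \<open>x \<otimes> g i = z \<otimes> v'\<close> h g_cancel by simp
        then have "z \<otimes> g h = v'" using zS v' by simp
        then obtain f where f: "h = Suc f" "z = letter f"
          using desc[of h z] z v' i h Suc by auto
        have "letter (f + 3) = letter (f + 1)" "letter (f + 2) = letter f"
          using f h i x_def by (simp_all add: eval_nat_numeral)
        then show False using nonperiodic by blast
      qed
      then show ?thesis using lenk Suc x_def by blast
    qed
  qed
  have "inj g" using main by (metis injI)
  moreover have "range g \<subseteq> carrier W" using g by blast
  ultimately show False using fin finite_subset range_inj_infinite by metis
qed

text \<open>Irreducibility gives two generators that do not commute and a third that fails to
  commute with one of them. Without a bond of order 3, both bonds would have order at least 4,
  contradicting \<open>no_consecutive_bonds_ge_4\<close>.\<close>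

lemma ex_bond_3:
  assumes fin: "finite (carrier W)" and irr: "coxeter_irreducible W S" and "3 \<le> card S"
  obtains s t where "s \<in> S" "t \<in> S" "ord (s \<otimes> t) = 3"
proof -
  note found = that
  have cut: "\<exists>a\<in>A. \<exists>b\<in>S - A. a \<otimes> b \<noteq> b \<otimes> a" if "A \<subseteq> S" "A \<noteq> {}" "S - A \<noteq> {}" for A
  proof (rule ccontr)
    assume "\<not> ?thesis"
    then have "\<forall>a\<in>A. \<forall>b\<in>S - A. a \<otimes> b = b \<otimes> a" by blast
    moreover have "A \<union> (S - A) = S" "A \<inter> (S - A) = {}" using that by auto
    ultimately show False using irr that unfolding coxeter_irreducible_def by metis
  qed
  have big: "S - A \<noteq> {}" if "finite A" "card A \<le> 2" for A
  proof
    assume "S - A = {}"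
    then have "card S \<le> card A" using that by (intro card_mono) auto
    then show False using that assms(3) by simp
  qed
  have ord_ge: "4 \<le> ord (x \<otimes> z)" if xz: "x \<in> S" "z \<in> S" "x \<otimes> z \<noteq> z \<otimes> x" and "ord (x \<otimes> z) \<noteq> 3" for x z
  proof -
    have "x \<noteq> z" using xz by blast
    then have "2 \<le> ord (x \<otimes> z)" using ord_gens_ge_2 fin xz by blast
    moreover have "ord (x \<otimes> z) \<noteq> 2"
    proof
      assume "ord (x \<otimes> z) = 2"
      then have "x \<otimes> z \<otimes> (x \<otimes> z) = \<one>" using pow_ord_eq_1[of "x \<otimes> z"] xz by (simp add: numeral_2_eq_2)
      then have "inv (x \<otimes> z) = x \<otimes> z" using xz by (intro inv_equality) auto
      then show False using xz by (simp add: inv_mult_group)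
    qed
    ultimately show ?thesis using that by linarith
  qed
  obtain s where s: "s \<in> S" using assms(3) by fastforce
  obtain b where b: "b \<in> S" "b \<noteq> s" "s \<otimes> b \<noteq> b \<otimes> s"
    using cut[of "{s}"] big[of "{s}"] s by auto
  have "\<exists>a\<in>{s, b}. \<exists>c\<in>S - {s, b}. a \<otimes> c \<noteq> c \<otimes> a"
    using cut[of "{s, b}"] big[of "{s, b}"] s b card_insert_le_m1[of 2 "{b}" s] by auto
  then obtain a a' c where a: "a \<in> S" "a' \<in> S" "c \<in> S" "a \<noteq> a'" "c \<noteq> a" "c \<noteq> a'"
    and nc: "a' \<otimes> a \<noteq> a \<otimes> a'" "a \<otimes> c \<noteq> c \<otimes> a"
  proof (elim bexE insertE, goal_cases)
    case (1 a c)
    then show ?case using that[of s b c] s b by auto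
  next
    case (2 a c)
    then show ?case using that[of b s c] s b by auto
  qed auto
  show thesis
  proof (rule ccontr)
    assume "\<not> thesis"
    then have "ord (x \<otimes> z) \<noteq> 3" if "x \<in> S" "z \<in> S" for x z using that found by blast
    then have "4 \<le> ord (a' \<otimes> a)" "4 \<le> ord (a \<otimes> c)" using ord_ge a nc by blast+
    then show False using no_consecutive_bonds_ge_4[OF fin a(2,1,3)] a by metis
  qed
qed

section \<open>The dihedral subgroup of a bond of order 3\<close>

lemma bond_3:
  assumes "s \<in> S" "t \<in> S" "ord (s \<otimes> t) = 3"
  shows "s \<otimes> (t \<otimes> s) = t \<otimes> (s \<otimes> t)" "s \<noteq> t" "len (s \<otimes> t) = 2" "len (t \<otimes> s) = 2" "len (s \<otimes> (t \<otimes> s)) = 3"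
proof -
  have "(s \<otimes> t) [^] (3::nat) = \<one>" using pow_ord_eq_1[of "s \<otimes> t"] assms by simp
  then have "(s \<otimes> (t \<otimes> s)) \<otimes> (t \<otimes> (s \<otimes> t)) = \<one>"
    using assms(1,2) by (simp add: eval_nat_numeral m_assoc)
  then have "inv (t \<otimes> (s \<otimes> t)) = s \<otimes> (t \<otimes> s)" using assms(1,2) by (intro inv_equality) auto
  then show braid: "s \<otimes> (t \<otimes> s) = t \<otimes> (s \<otimes> t)" using assms(1,2) by (simp add: inv_mult_group m_assoc)
  show neq: "s \<noteq> t" using assms by auto
  have len2: "len (x \<otimes> y) = 2" if xy: "x \<in> S" "y \<in> S" "x \<noteq> y" for x y
  proof -
    have "x \<otimes> y \<noteq> \<one>"
    proof
      assume "x \<otimes> y = \<one>"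
      then have "x \<otimes> (x \<otimes> y) = x" using xy by simp
      then show False using xy by simp
    qed
    then have "len (x \<otimes> y) \<noteq> 0" using len_eq_0_iff xy by simp
    then show ?thesis using len_gen_mult_cases[of x y] xy by simp
  qed
  show "len (s \<otimes> t) = 2" and ts: "len (t \<otimes> s) = 2" using len2 assms neq by auto
  have "\<not> len (s \<otimes> (t \<otimes> s)) < len (t \<otimes> s)"
  proof
    assume "len (s \<otimes> (t \<otimes> s)) < len (t \<otimes> s)"
    then have "len (s \<otimes> t) < len t \<or> (\<exists>r\<in>carrier W. s \<otimes> t = t \<otimes> r \<and> len (r \<otimes> s) < len s)"
      using exchange[of s t s] assms by simp
    then obtain r where r: "r \<in> carrier W" "s \<otimes> t = t \<otimes> r" "len (r \<otimes> s) < len s"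
      using len2[OF assms(1,2) neq] assms by auto
    then have "r \<otimes> s = \<one>" using assms len_eq_0_iff[of "r \<otimes> s"] by simp
    then have "r \<otimes> s \<otimes> s = s" using assms by simp
    then have "r = s" using assms r by (simp add: m_assoc)
    \<comment> \<open>Now \<open>s t = t s\<close>, which makes the square of \<open>s t\<close>
      trivial, against order 3.\<close>
    then have "(s \<otimes> t) [^] (2::nat) = t \<otimes> s \<otimes> (s \<otimes> t)"
      using r(2) assms(1,2) by (simp add: numeral_2_eq_2)
    also have "\<dots> = \<one>" using assms(1,2) by (simp add: m_assoc)
    finally have "(3::nat) dvd 2" using pow_eq_id[of "s \<otimes> t" 2] assms by simp
    then show False by simp
  qed
  then show "len (s \<otimes> (t \<otimes> s)) = 3" using len_gen_mult_cases[of s "t \<otimes> s"] assms ts by simp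
qed

lemma generate_single: "s \<in> S \<Longrightarrow> generate W {s} = {\<one>, s}"
proof
  assume s: "s \<in> S"
  have "word_prod W u \<in> {\<one>, s}" if "u \<in> lists {s}" for u
    using that by (induction u) (use s in auto)
  then show "generate W {s} \<subseteq> {\<one>, s}" using generate_eq_word_prods[of "{s}"] s by auto
  show "{\<one>, s} \<subseteq> generate W {s}" by (auto intro: generate.one generate.incl)
qed

lemma generate_bond_3:
  assumes "s \<in> S" "t \<in> S" "ord (s \<otimes> t) = 3" "a \<in> generate W {s, t}"
  shows "a \<in> {\<one>, s, t, s \<otimes> t, t \<otimes> s, s \<otimes> (t \<otimes> s)}"
proof -
  note braid = bond_3(1)[OF assms(1-3)]
  have steps: "s \<otimes> (s \<otimes> (t \<otimes> s)) = t \<otimes> s" "t \<otimes> (s \<otimes> t) = s \<otimes> (t \<otimes> s)"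
    "t \<otimes> (s \<otimes> (t \<otimes> s)) = s \<otimes> t" "s \<otimes> (s \<otimes> t) = t" "t \<otimes> (t \<otimes> s) = s"
  proof -
    show "t \<otimes> (s \<otimes> (t \<otimes> s)) = s \<otimes> t" unfolding braid using assms(1,2) by simp
    show "t \<otimes> (s \<otimes> t) = s \<otimes> (t \<otimes> s)" using braid by simp
  qed (use assms(1,2) in simp_all)
  have "word_prod W u \<in> {\<one>, s, t, s \<otimes> t, t \<otimes> s, s \<otimes> (t \<otimes> s)}" if "u \<in> lists {s, t}" for u
    using that
  proof (induction u)
    case Nil
    then show ?case by simp
  next
    case (Cons x u)
    from Cons.hyps(1) consider "x = s" | "x = t" by blast
    then show ?case
    proof cases
      case 1
      then show ?thesis using Cons.IH assms(1,2) steps by (elim insertE) simp_all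
    next
      case 2
      then show ?thesis using Cons.IH assms(1,2) steps by (elim insertE) simp_all
    qed
  qed
  then show ?thesis using assms generate_eq_word_prods[of "{s, t}"] by auto
qed

end

section \<open>The Weyl distance\<close>

context building
begin

lemma dist_self [simp]: "x \<in> Ch \<Longrightarrow> \<delta> x x = \<one>"
  by (simp add: WD1)

lemma dist_gen_sym:
  assumes "x \<in> Ch" "y \<in> Ch" "\<delta> x y \<in> S"
  shows "\<delta> y x = \<delta> x y"
proof -
  have "\<delta> x x \<in> {\<delta> x y \<otimes> \<delta> y x, \<delta> y x}" 
    using WD2[OF assms(2,1,1,3) HOL.refl] by (rule conjunct1)
  then consider "\<delta> x y \<otimes> \<delta> y x = \<one>" | "\<delta> y x = \<one>" using dist_self[OF assms(1)] by auto
  then show ?thesis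
  proof cases
    case 1
    then have "\<delta> x y \<otimes> (\<delta> x y \<otimes> \<delta> y x) = \<delta> x y" using assms by simp
    then show ?thesis using assms(3) dist_closed[OF assms(2,1)] by simp
  next
    case 2
    then have "x = y" using WD1[OF assms(2,1)] by simp
    then show ?thesis by simp
  qed
qed

lemma ex_step:
  assumes "x \<in> Ch" "y \<in> Ch" "s \<in> S"
  obtains z where "z \<in> Ch" "\<delta> x z = s" "\<delta> z x = s" "\<delta> z y = s \<otimes> \<delta> x y"
proof -
  obtain z where z: "z \<in> Ch" "\<delta> z x = s" "\<delta> z y = s \<otimes> \<delta> x y" using WD3[OF assms] by blast
  have "\<delta> x z = s" using dist_gen_sym[OF z(1) assms(1)] z(2) assms(3) by simp
  then show ?thesis using that[OF z(1)] z by simp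
qed

text \<open>Replace \<open>x\<close> by an \<open>s\<close>-neighbour \<open>x'\<close> closer to
  \<open>y\<close>. The lengths still add up, so \<open>s\<close> lengthens the distance from
  \<open>x'\<close> to \<open>z\<close>, and the second clause of \<open>WD2\<close> determines the
  distance from \<open>x\<close>.\<close>

lemma dist_mult:
  assumes "x \<in> Ch" "y \<in> Ch" "z \<in> Ch"
    and "len (\<delta> x y \<otimes> \<delta> y z) = len (\<delta> x y) + len (\<delta> y z)"
  shows "\<delta> x z = \<delta> x y \<otimes> \<delta> y z"
  using assms(1,4)
proof (induction "len (\<delta> x y)" arbitrary: x rule: less_induct)
  case less
  define a where "a = \<delta> x y"
  define b where "b = \<delta> y z"
  have ab: "a \<in> carrier W" "b \<in> carrier W" using dist_closed less.prems assms by (auto simp: a_def b_def)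
  show ?case
  proof (cases "a = \<one>")
    case True
    then have "x = y" using WD1[OF less.prems(1) assms(2)] by (simp add: a_def)
    then show ?thesis using assms(2,3) dist_closed[OF assms(2,3)] by simp
  next
    case False
    then obtain s where s: "s \<in> S" "len a = len (s \<otimes> a) + 1" using ex_descent[OF ab(1)] by blast
    obtain x' where x': "x' \<in> Ch" "\<delta> x x' = s" "\<delta> x' x = s" "\<delta> x' y = s \<otimes> a"
      using ex_step[OF less.prems(1) assms(2) s(1)] unfolding a_def .
    have lab: "len (a \<otimes> b) = len a + len b" using less.prems(2) by (simp add: a_def b_def)
    have "len (s \<otimes> a \<otimes> b) \<le> len (s \<otimes> a) + len b" using len_mult_le s ab by simp
    then have 1: "len (s \<otimes> a \<otimes> b) = len (s \<otimes> a) + len b" "len (a \<otimes> b) = len (s \<otimes> a \<otimes> b) + 1"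
      using len_gen_mult_cases[of s "a \<otimes> b"] lab s ab by (auto simp: m_assoc)
    have "\<delta> x' z = s \<otimes> a \<otimes> b"
      using less.hyps[of x'] x'(1) 1(1) s(2) unfolding x'(4) a_def[symmetric] b_def[symmetric] by simp
    moreover have "s \<otimes> (s \<otimes> a \<otimes> b) = a \<otimes> b" using s ab by (simp add: m_assoc)
    ultimately show ?thesis
      using WD2[OF x'(1) assms(3) less.prems(1) s(1) x'(2)] 1 unfolding a_def[symmetric] b_def[symmetric] by simp
  qed
qed

text \<open>The axioms move only the first chamber. Stepping from \<open>x\<close> towards
  \<open>y\<close> and reversing inductively, \<open>dist_mult\<close> appends the first letter on
  the right, where lengths add up because \<open>s\<close> is a descent.\<close>

lemma dist_inv:
  assumes "x \<in> Ch" "y \<in> Ch"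
  shows "\<delta> y x = inv (\<delta> x y)"
  using assms(1)
proof (induction "len (\<delta> x y)" arbitrary: x rule: less_induct)
  case less
  define w where "w = \<delta> x y"
  have w: "w \<in> carrier W" using dist_closed less.prems assms by (simp add: w_def)
  show ?case
  proof (cases "w = \<one>")
    case True
    then have "x = y" using WD1[OF less.prems assms(2)] by (simp add: w_def)
    then show ?thesis using assms by simp
  next
    case False
    then obtain s where s: "s \<in> S" "len w = len (s \<otimes> w) + 1" using ex_descent[OF w] by blast
    obtain x' where x': "x' \<in> Ch" "\<delta> x' x = s" "\<delta> x' y = s \<otimes> w"
      using ex_step[OF less.prems(1) assms(2) s(1)] unfolding w_def by blast
    have yx': "\<delta> y x' = inv (s \<otimes> w)"
      using less.hyps[of x'] x' s(2) unfolding w_def[symmetric] by simp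
    have eq: "\<delta> y x' \<otimes> \<delta> x' x = inv w"
      unfolding yx' x'(2) using s w by (simp add: inv_mult_group m_assoc)
    have "len (inv w) = len (\<delta> y x') + len (\<delta> x' x)" unfolding yx' x'(2) using s w by simp
    then have "\<delta> y x = inv w" using dist_mult[of y x' x] eq x' less.prems assms by simp
    then show ?thesis by (simp add: w_def)
  qed
qed

text \<open>The counterpart of \<open>WD2\<close> for a move of the second chamber, obtained by
  inverting distances.\<close>

lemma dist_gen_cases:
  assumes "x \<in> Ch" "y \<in> Ch" "z \<in> Ch" "\<delta> y z = s" "s \<in> S"
  shows "\<delta> x z = \<delta> x y \<or> \<delta> x z = \<delta> x y \<otimes> s"
proof -
  have "\<delta> z y = s" using dist_gen_sym[of y z] assms by simp
  then have "\<delta> z x \<in> {s \<otimes> \<delta> y x, \<delta> y x}" using WD2[OF assms(2,1,3,5)] by blast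
  then have "inv (\<delta> z x) = inv (s \<otimes> \<delta> y x) \<or> inv (\<delta> z x) = inv (\<delta> y x)" by auto
  then show ?thesis
    using dist_inv[of z x] dist_inv[of y x] dist_closed[of y x] assms by (auto simp: inv_mult_group)
qed

text \<open>Lengths need not add up here, so \<open>dist_mult\<close> does not apply. Instead
  \<open>x\<close> moves to \<open>y\<close> along a word in \<open>J\<close>, and by
  \<open>WD2\<close> each step changes the distance to \<open>z\<close> by at most a letter of
  \<open>J\<close>.\<close>

lemma residue_trans:
  assumes J: "J \<subseteq> S" and "x \<in> Ch" "y \<in> Ch" "z \<in> Ch" "\<delta> x y \<in> generate W J" "\<delta> y z \<in> generate W J"
  shows "\<delta> x z \<in> generate W J"
proof -
  obtain u where "u \<in> lists J" "\<delta> x y = word_prod W u"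
    using assms(5) generate_eq_word_prods[OF J] by auto
  then show ?thesis using \<open>x \<in> Ch\<close>
  proof (induction u arbitrary: x)
    case Nil
    then have "x = y" using WD1 assms by simp
    then show ?case using assms by simp
  next
    case (Cons s u)
    have s: "s \<in> S" "s \<in> J" and u: "u \<in> lists S" using Cons.hyps J lists_mono[OF J] by auto
    obtain x' where x': "x' \<in> Ch" "\<delta> x x' = s" "\<delta> x' y = s \<otimes> \<delta> x y"
      using ex_step[OF Cons.prems(2) assms(3) s(1)] by blast
    have "\<delta> x' y = word_prod W u" using x'(3) Cons.prems s u by simp
    then have "\<delta> x' z \<in> generate W J" using Cons.IH x' by blast
    moreover have "\<delta> x z \<in> {s \<otimes> \<delta> x' z, \<delta> x' z}" 
      using WD2[OF x'(1) assms(4) Cons.prems(2) s(1) x'(2)] by blast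
    ultimately show ?case using s by (auto intro: generate.eng[OF generate.incl])
  qed
qed

lemma residue_sym:
  assumes "J \<subseteq> S" "x \<in> Ch" "y \<in> Ch" "\<delta> x y \<in> generate W J"
  shows "\<delta> y x \<in> generate W J"
  using dist_inv[of x y] subgroup.m_inv_closed[OF parabolic_subgroup[OF assms(1)]] assms by simp

end

section \<open>Involutions of spherical buildings\<close>

text \<open>The type automorphism \<open>\<sigma>\<close>, existentially quantified in
  \<open>building_automorphism\<close>, becomes a parameter.\<close>

locale spherical_building_involution = spherical_building W S Ch \<delta>
  for W (structure) and S and Ch :: "'c set" and \<delta> +
  fixes \<theta> :: "'c \<Rightarrow> 'c" and \<sigma>
  assumes theta_closed [simp]: "x \<in> Ch \<Longrightarrow> \<theta> x \<in> Ch"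
    and theta_theta [simp]: "x \<in> Ch \<Longrightarrow> \<theta> (\<theta> x) = x"
    and sigma_iso: "\<sigma> \<in> iso W W"
    and sigma_gens: "\<sigma> ` S = S"
    and dist_theta: "\<lbrakk>x \<in> Ch; y \<in> Ch\<rbrakk> \<Longrightarrow> \<delta> (\<theta> x) (\<theta> y) = \<sigma> (\<delta> x y)"
begin

lemma sigma_closed [simp]: "w \<in> carrier W \<Longrightarrow> \<sigma> w \<in> carrier W"
  using sigma_iso unfolding iso_def by (auto intro: hom_in_carrier)

lemma sigma_mult: "v \<in> carrier W \<Longrightarrow> w \<in> carrier W \<Longrightarrow> \<sigma> (v \<otimes> w) = \<sigma> v \<otimes> \<sigma> w"
  using sigma_iso unfolding iso_def by (auto intro: hom_mult)

lemma sigma_one [simp]: "\<sigma> \<one> = \<one>"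
  using sigma_iso hom_one[OF _ is_group is_group] unfolding iso_def by blast

lemma sigma_gen [simp]: "s \<in> S \<Longrightarrow> \<sigma> s \<in> S"
  using sigma_gens by blast

lemma sigma_word_prod: "u \<in> lists S \<Longrightarrow> \<sigma> (word_prod W u) = word_prod W (map \<sigma> u)"
  by (induction u) (auto simp: sigma_mult)

lemma len_sigma [simp]:
  assumes w: "w \<in> carrier W"
  shows "len (\<sigma> w) = len w"
proof (rule antisym)
  obtain u where u: "u \<in> lists S" "length u = len w" "word_prod W u = w" using ex_reduced_word[OF w] .
  have "map \<sigma> u \<in> map \<sigma> ` lists S" using u(1) by blast
  then have "map \<sigma> u \<in> lists S" using sigma_gens lists_image[of \<sigma> S] by simp
  then show "len (\<sigma> w) \<le> len w" using len_le[of "map \<sigma> u"] sigma_word_prod[OF u(1)] u by simp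
next
  obtain v where v: "v \<in> lists S" "length v = len (\<sigma> w)" "word_prod W v = \<sigma> w"
    using ex_reduced_word[of "\<sigma> w"] w by auto
  have "v \<in> map \<sigma> ` lists S" using v(1) lists_image[of \<sigma> S] sigma_gens by simp
  then obtain u where u: "u \<in> lists S" "v = map \<sigma> u" by blast
  then have "\<sigma> (word_prod W u) = \<sigma> w" using v sigma_word_prod by simp
  moreover have "inj_on \<sigma> (carrier W)" using sigma_iso by (auto simp: iso_def bij_betw_def)
  ultimately have "word_prod W u = w" using u w by (simp add: inj_on_eq_iff)
  then show "len w \<le> len (\<sigma> w)" using len_le[OF u(1)] u v by simp
qed

text \<open>Applying \<open>\<theta>\<close> to the pair of \<open>x\<close> and
  \<open>\<theta> x\<close> interchanges its members.\<close>

lemma displacement_sigma: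
  assumes "x \<in> Ch"
  shows "\<sigma> (\<delta> x (\<theta> x)) = inv (\<delta> x (\<theta> x))"
  using dist_theta[of x "\<theta> x"] dist_inv[of x "\<theta> x"] assms by simp

lemma minimal_displacement_fixes_simplex:
  assumes x: "x \<in> Ch" and min: "\<And>y. y \<in> Ch \<Longrightarrow> len (\<delta> x (\<theta> x)) \<le> len (\<delta> y (\<theta> y))"
    and not_longest: "\<not> longest_element W S (\<delta> x (\<theta> x))"
  shows "fixes_simplex W S Ch \<delta> \<theta>"
proof -
  define w where "w = \<delta> x (\<theta> x)"
  have w: "w \<in> carrier W" using x dist_closed by (simp add: w_def)
  have sigma_w: "\<sigma> w = inv w" using displacement_sigma[OF x] by (simp add: w_def)
  define J where "J = {s \<in> S. len (s \<otimes> w) < len w}"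
  have J: "J \<subseteq> S" by (auto simp: J_def)
  have "J \<noteq> S" using not_longest longest_iff_all_descents[OF w] unfolding w_def[symmetric] J_def by blast
  have sub: "subgroup (generate W J) W" using parabolic_subgroup[OF J] .
  have comm: "s \<otimes> w = w \<otimes> \<sigma> s" if "s \<in> J" for s
  proof -
    have s: "s \<in> S" and desc: "len (s \<otimes> w) < len w" using that by (auto simp: J_def)
    obtain y where y: "y \<in> Ch" "\<delta> x y = s" "\<delta> y (\<theta> x) = s \<otimes> w"
      using ex_step[OF x theta_closed[OF x] s] unfolding w_def by blast
    have "\<delta> (\<theta> x) (\<theta> y) = \<sigma> s" using dist_theta x y by simp
    \<comment> \<open>The displacement \<open>s w\<close> would be shorter than the minimum, so
      \<open>y\<close> has displacement \<open>s w \<sigma>(s)\<close>, which is therefore at least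
      as long as \<open>w\<close>.\<close>
    then have "\<delta> y (\<theta> y) = s \<otimes> w \<or> \<delta> y (\<theta> y) = s \<otimes> w \<otimes> \<sigma> s"
      using dist_gen_cases[of y "\<theta> x" "\<theta> y" "\<sigma> s"] x y s by simp
    then have ge: "len w \<le> len (s \<otimes> w \<otimes> \<sigma> s)"
      using min[OF y(1)] desc unfolding w_def[symmetric] by (elim disjE) simp_all
    \<comment> \<open>As \<open>\<sigma> w = inv w\<close>, inversion followed by
      \<open>\<sigma>\<close> turns the left descent \<open>s\<close> of \<open>w\<close> into the
      right descent \<open>\<sigma> s\<close>.\<close>
    have "inv (w \<otimes> \<sigma> s) = \<sigma> (s \<otimes> w)" 
      using w s by (simp add: inv_mult_group sigma_mult sigma_w)
    moreover have "len (inv (w \<otimes> \<sigma> s)) = len (w \<otimes> \<sigma> s)" "len (\<sigma> (s \<otimes> w)) = len (s \<otimes> w)"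
      using w s by simp_all
    ultimately have "len (w \<otimes> \<sigma> s) < len w" using desc by simp
    then show ?thesis by (rule commute_of_len[OF s sigma_gen[OF s] w desc _ ge])
  qed
  have commJ: "b \<otimes> w = w \<otimes> \<sigma> b" if b: "b \<in> generate W J" for b
  proof -
    obtain u where "u \<in> lists J" "b = word_prod W u" using b generate_eq_word_prods[OF J] by auto
    then show ?thesis
    proof (induction u arbitrary: b)
      case Nil
      then show ?case using w by simp
    next
      case (Cons s u)
      have s: "s \<in> S" "s \<in> J" and u: "word_prod W u \<in> carrier W"
        using Cons.hyps J lists_mono[OF J] by auto
      have "b \<otimes> w = s \<otimes> (word_prod W u \<otimes> w)" using Cons.prems s u w by (simp add: m_assoc)
      also have "\<dots> = s \<otimes> w \<otimes> \<sigma> (word_prod W u)"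
        using Cons.IH[OF HOL.refl] s u w by (simp add: m_assoc)
      also have "\<dots> = w \<otimes> \<sigma> s \<otimes> \<sigma> (word_prod W u)" by (simp only: comm[OF s(2)])
      finally show ?case using Cons.prems s u w by (simp add: m_assoc sigma_mult)
    qed
  qed
  obtain a v where a: "a \<in> generate W J" and v: "v \<in> carrier W" and w_eq: "w = a \<otimes> v"
    and additive: "\<And>b. b \<in> generate W J \<Longrightarrow> len (b \<otimes> v) = len b + len v"
    by (rule ex_parabolic_factorization[OF J w]) (rule that)
  have ac: "a \<in> carrier W" using a J parabolic_closed by blast
  \<comment> \<open>Move \<open>a\<close> across \<open>w\<close> by \<open>commJ\<close> and cancel
    it on the left.\<close>
  have w_eq': "w = v \<otimes> \<sigma> a"
  proof -
    have "a \<otimes> w = a \<otimes> (v \<otimes> \<sigma> a)" using commJ[OF a] w_eq ac v by (simp add: m_assoc)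
    then show ?thesis using ac v w by simp
  qed
  \<comment> \<open>A left descent \<open>r\<close> of \<open>v\<close> is one of
    \<open>w = v \<sigma>(a)\<close>, because the lengths of \<open>a\<close> and \<open>v\<close>
    add up to that of \<open>w\<close>. Then \<open>r\<close> lies in \<open>J\<close>, and
    additivity says that it lengthens \<open>v\<close>.\<close>
  have "v = \<one>"
  proof (rule ccontr)
    assume "v \<noteq> \<one>"
    then obtain r where r: "r \<in> S" "len v = len (r \<otimes> v) + 1" using ex_descent[OF v] by blast
    have "r \<otimes> w = (r \<otimes> v) \<otimes> \<sigma> a" unfolding w_eq' using r v ac by (simp add: m_assoc)
    then have "len (r \<otimes> w) \<le> len (r \<otimes> v) + len a"
      using len_mult_le[of "r \<otimes> v" "\<sigma> a"] r v ac by simp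
    moreover have "len w = len a + len v" using additive[OF a] w_eq by simp
    ultimately have "r \<in> J" using r by (simp add: J_def)
    then have "len (r \<otimes> v) = len r + len v" by (intro additive generate.incl)
    then show False using r by simp
  qed
  then have wJ: "w \<in> generate W J" using w_eq a ac by simp
  \<comment> \<open>On the parabolic subgroup \<open>\<sigma>\<close> is conjugation by
    \<open>w\<close>, which now lies in this subgroup.\<close>
  have sigmaJ: "\<sigma> b \<in> generate W J" if b: "b \<in> generate W J" for b
  proof -
    have bc: "b \<in> carrier W" using b J parabolic_closed by blast
    have "\<sigma> b = inv w \<otimes> (b \<otimes> w)" using commJ[OF b] w bc by simp
    then show ?thesis using sub wJ b by (simp add: subgroup.m_closed subgroup.m_inv_closed)
  qed
  define R where "R = {y \<in> Ch. \<delta> x y \<in> generate W J}"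
  have closed: "\<theta> y \<in> R" if "y \<in> R" for y
  proof -
    have y: "y \<in> Ch" "\<delta> x y \<in> generate W J" using that by (auto simp: R_def)
    have "\<delta> (\<theta> x) (\<theta> y) \<in> generate W J" using dist_theta x y sigmaJ by simp
    then show ?thesis
      using residue_trans[OF J x, of "\<theta> x" "\<theta> y"] wJ x y by (simp add: R_def w_def)
  qed
  have "\<theta> ` R = R"
  proof
    show "\<theta> ` R \<subseteq> R" using closed by blast
    show "R \<subseteq> \<theta> ` R"
    proof
      fix y assume y: "y \<in> R"
      then have "\<theta> (\<theta> y) = y" by (simp add: R_def)
      then show "y \<in> \<theta> ` R" using closed[OF y] by (metis imageI)
    qed
  qed
  moreover have "is_residue W Ch \<delta> J R" using x unfolding is_residue_def R_def by blast
  ultimately show ?thesis using J \<open>J \<noteq> S\<close> unfolding fixes_simplex_def by blast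
qed

lemma all_opposite_or_fixes_simplex:
  "(\<forall>x\<in>Ch. opposite W S \<delta> x (\<theta> x)) \<or> fixes_simplex W S Ch \<delta> \<theta>"
proof (rule disjCI)
  assume no_fix: "\<not> fixes_simplex W S Ch \<delta> \<theta>"
  define x where "x = arg_min (\<lambda>x. len (\<delta> x (\<theta> x))) (\<lambda>x. x \<in> Ch)"
  obtain x0 where "x0 \<in> Ch" using nonempty by blast
  then have x: "x \<in> Ch" and min: "\<And>y. y \<in> Ch \<Longrightarrow> len (\<delta> x (\<theta> x)) \<le> len (\<delta> y (\<theta> y))"
    using arg_min_natI[of "\<lambda>x. x \<in> Ch" x0 "\<lambda>x. len (\<delta> x (\<theta> x))"]
      arg_min_nat_le[of "\<lambda>x. x \<in> Ch" _ "\<lambda>x. len (\<delta> x (\<theta> x))"] by (auto simp: x_def)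
  \<comment> \<open>Since the shortest displacement is already of maximal length, every displacement
    is.\<close>
  have L: "longest_element W S (\<delta> x (\<theta> x))"
    using minimal_displacement_fixes_simplex[OF x min] no_fix by blast
  show "\<forall>x\<in>Ch. opposite W S \<delta> x (\<theta> x)"
  proof
    fix y assume y: "y \<in> Ch"
    then have "\<delta> y (\<theta> y) \<in> carrier W" using dist_closed by simp
    moreover have "\<not> len (\<delta> y (\<theta> y)) < len z" if "z \<in> carrier W" for z
      using L min[OF y] that unfolding longest_element_def is_arg_max_def by fastforce
    ultimately show "opposite W S \<delta> y (\<theta> y)"
      unfolding opposite_def longest_element_def is_arg_max_def by blast
  qed
qed

text \<open>The \<open>s\<close>-panels and \<open>t\<close>-panels in an
  \<open>{s, t}\<close>-residue \<open>R\<close> are the points and lines of a projective plane. The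
  polarity sends \<open>c\<close> to the chamber of \<open>R\<close> nearest to
  \<open>\<theta> c\<close>. It interchanges points and lines because conjugation by the longest
  element \<open>s t s\<close> swaps \<open>s\<close> and \<open>t\<close>.\<close>

lemma not_all_opposite:
  assumes opp: "\<forall>x\<in>Ch. opposite W S \<delta> x (\<theta> x)" and fin: "finite Ch" and thick: "thick W S Ch \<delta>"
    and s: "s \<in> S" and t: "t \<in> S" and ord3: "ord (s \<otimes> t) = 3"
  shows False
proof -
  note [simp] = s t
  note bond = bond_3[OF s t ord3]
  obtain x0 where x0: "x0 \<in> Ch" using nonempty by blast
  define w where "w = \<delta> x0 (\<theta> x0)"
  have w: "w \<in> carrier W" using x0 dist_closed by (simp add: w_def)
  have w_long: "longest_element W S w" using opp x0 by (simp add: opposite_def w_def)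
  have disp: "\<delta> x (\<theta> x) = w" if "x \<in> Ch" for x
    using longest_unique[OF _ w_long] opp that by (simp add: opposite_def)
  have sigma_w: "\<sigma> w = w" using dist_theta[of x0 "\<theta> x0"] disp[of "\<theta> x0"] x0 by (simp add: w_def)
  then have inv_w: "inv w = w" using displacement_sigma[OF x0] by (simp add: w_def)
  then have ww: "w \<otimes> w = \<one>" using r_inv[OF w] by simp
  have ww': "w \<otimes> (w \<otimes> a) = a" if "a \<in> carrier W" for a
    using ww that w by (simp flip: m_assoc)
  \<comment> \<open>Adjacent chambers have the same displacement \<open>w\<close>, and comparing
    them across an \<open>r\<close>-panel determines \<open>\<sigma> r\<close>.\<close>
  have sigma_conj: "\<sigma> r = w \<otimes> (r \<otimes> w)" if r: "r \<in> S" for r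
  proof -
    obtain y where y: "y \<in> Ch" "\<delta> x0 y = r" "\<delta> y (\<theta> x0) = r \<otimes> w"
      using ex_step[OF x0 theta_closed[OF x0] r] unfolding w_def by blast
    have "\<delta> (\<theta> x0) (\<theta> y) = \<sigma> r" using dist_theta[OF x0 y(1)] y(2) by simp
    from dist_gen_cases[OF y(1) theta_closed[OF x0] theta_closed[OF y(1)] this sigma_gen[OF r]]
    have "w = r \<otimes> w \<or> w = r \<otimes> w \<otimes> \<sigma> r" unfolding disp[OF y(1)] y(3) .
    moreover have "w \<noteq> r \<otimes> w" using len_gen_mult_cases[OF r w] by auto
    ultimately have "w = r \<otimes> (w \<otimes> \<sigma> r)" using r w by (simp add: m_assoc)
    then have "r \<otimes> w = r \<otimes> (r \<otimes> (w \<otimes> \<sigma> r))" by simp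
    then have "r \<otimes> w = w \<otimes> \<sigma> r" using r w by simp
    then have "w \<otimes> (r \<otimes> w) = w \<otimes> (w \<otimes> \<sigma> r)" by simp
    then show ?thesis using ww' r by simp
  qed
  define G where "G = generate W {s, t}"
  have J: "{s, t} \<subseteq> S" by simp
  have G_sub: "subgroup G W" using parabolic_subgroup[OF J] by (simp add: G_def)
  have G_carrier: "a \<in> carrier W" if "a \<in> G" for a using G_sub that by (rule subgroup.mem_carrier)
  have G_cases: "a \<in> {\<one>, s, t, s \<otimes> t, t \<otimes> s, s \<otimes> (t \<otimes> s)}" if "a \<in> G" for a
    using generate_bond_3[OF s t ord3] that by (simp add: G_def)
  have G_len: "len a \<le> 3" if "a \<in> G" for a
    using G_cases[OF that] bond by (elim insertE) simp_all
  have sG: "s \<in> G" and tG: "t \<in> G" by (auto simp: G_def intro: generate.incl)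
  have genG: "a \<in> G" if "a \<in> generate W {r}" "r \<in> {s, t}" for a r
    using mono_generate[of "{r}" "{s, t}"] that by (auto simp: G_def)
  define m where "m = s \<otimes> (t \<otimes> s)"
  have m: "m \<in> carrier W" by (simp add: m_def)
  have mG: "m \<in> G" using sG tG subgroup.m_closed[OF G_sub] by (simp add: m_def)
  have inv_m: "inv m = m" by (simp add: m_def inv_mult_group m_assoc)
  have mm: "m \<otimes> m = \<one>" using r_inv[OF m] by (simp add: inv_m)
  have m_swap: "m \<otimes> s = t \<otimes> m" "m \<otimes> t = s \<otimes> m"
  proof -
    have "t \<otimes> m = t \<otimes> (t \<otimes> (s \<otimes> t))" by (simp only: m_def bond(1))
    then show "m \<otimes> s = t \<otimes> m" by (simp add: m_def m_assoc)
    have "m \<otimes> t = t \<otimes> (s \<otimes> t) \<otimes> t" by (simp only: m_def bond(1))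
    then show "m \<otimes> t = s \<otimes> m" by (simp add: m_def m_assoc)
  qed
  define v where "v = m \<otimes> w"
  have v: "v \<in> carrier W" using m w by (simp add: v_def)
  have mv: "m \<otimes> v = w" using m w mm by (simp add: v_def flip: m_assoc)
  \<comment> \<open>Splitting \<open>w\<close> by \<open>len_complement\<close> after
    \<open>c m\<close> and after \<open>m\<close> shows that \<open>v\<close> is shortest in its
    coset, because no element of \<open>G\<close> is longer than \<open>m\<close>.\<close>
  have len_v: "len (b \<otimes> v) = len b + len v" if b: "b \<in> G" for b
  proof -
    have desc: "len (r \<otimes> w) < len w" if "r \<in> S" for r
      using longest_iff_all_descents[OF w] w_long that by blast
    have comp: "len w = len c + len (c \<otimes> w)" if c: "c \<in> carrier W" for c
      using len_complement[OF w desc, of "inv c"] c by simp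
    have "len v \<le> len (c \<otimes> v)" if c: "c \<in> G" for c
    proof -
      have cc: "c \<in> carrier W" using G_carrier c .
      have "len (c \<otimes> m) \<le> 3" using G_len subgroup.m_closed[OF G_sub c mG] by blast
      moreover have "len w = len (c \<otimes> m) + len (c \<otimes> v)"
        using comp[of "c \<otimes> m"] cc m w by (simp add: v_def m_assoc)
      moreover have "len w = 3 + len v" using comp[OF m] bond(5) by (simp add: v_def m_def)
      ultimately show ?thesis by simp
    qed
    then show ?thesis using len_mult_coset_minimal[OF J v] b by (simp add: G_def)
  qed
  define R where "R = {y \<in> Ch. \<delta> x0 y \<in> G}"
  have R_Ch: "c \<in> Ch" if "c \<in> R" for c using that by (simp add: R_def)
  have R_dist: "\<delta> c d \<in> G" if "c \<in> R" "d \<in> R" for c d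
    using residue_trans[OF J, of c x0 d] residue_sym[OF J, of x0 c] that x0 by (simp add: R_def G_def)
  have R_step: "d \<in> R" if "c \<in> R" "d \<in> Ch" "\<delta> c d \<in> G" for c d
    using residue_trans[OF J, of x0 c d] that x0 by (simp add: R_def G_def)
  \<comment> \<open>The gate property: a chamber \<open>d\<close> of \<open>R\<close> at distance
    \<open>v\<close> from \<open>z\<close> is the projection of \<open>z\<close> to
    \<open>R\<close>, and distances from \<open>R\<close> to \<open>z\<close> factor through
    it.\<close>
  have to_v: "\<delta> c z = \<delta> c d \<otimes> v" if "c \<in> R" "d \<in> R" "z \<in> Ch" "\<delta> d z = v" for c d z
    using dist_mult[of c d z] len_v[of "\<delta> c d"] R_dist R_Ch that by simp
  \<comment> \<open>Starting at \<open>c\<close>, walk across panels of types \<open>s\<close>,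
    \<open>t\<close>, \<open>s\<close> towards \<open>\<theta> c\<close>; this strips
    \<open>m\<close> off \<open>w\<close>.\<close>
  have "\<exists>y. y \<in> R \<and> \<delta> y (\<theta> c) = v" if c: "c \<in> R" for c
  proof -
    have cC: "c \<in> Ch" "\<theta> c \<in> Ch" using c by (auto simp: R_def)
    obtain c1 where c1: "c1 \<in> Ch" "\<delta> c c1 = s" "\<delta> c1 (\<theta> c) = s \<otimes> w"
      using ex_step[OF cC s] disp[OF cC(1)] by metis
    obtain c2 where c2: "c2 \<in> Ch" "\<delta> c1 c2 = t" "\<delta> c2 (\<theta> c) = t \<otimes> (s \<otimes> w)"
      using ex_step[OF c1(1) cC(2) t] c1(3) by metis
    obtain c3 where c3: "c3 \<in> Ch" "\<delta> c2 c3 = s" "\<delta> c3 (\<theta> c) = s \<otimes> (t \<otimes> (s \<otimes> w))"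
      using ex_step[OF c2(1) cC(2) s] c2(3) by metis
    have "c1 \<in> R" using R_step[OF c c1(1)] c1(2) sG by simp
    then have "c2 \<in> R" using R_step[OF _ c2(1)] c2(2) tG by metis
    then have "c3 \<in> R" using R_step[OF _ c3(1)] c3(2) sG by metis
    moreover have "\<delta> c3 (\<theta> c) = v" using c3(3) w by (simp add: v_def m_def m_assoc)
    ultimately show ?thesis by blast
  qed
  then obtain \<phi> where phi: "\<And>c. c \<in> R \<Longrightarrow> \<phi> c \<in> R" "\<And>c. c \<in> R \<Longrightarrow> \<delta> (\<phi> c) (\<theta> c) = v" by metis
  have phi_unique: "y = \<phi> c" if c: "c \<in> R" and y: "y \<in> R" "\<delta> y (\<theta> c) = v" for c y
  proof -
    have "\<delta> y (\<phi> c) \<otimes> v = \<one> \<otimes> v"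
      using to_v[OF y(1) phi(1)[OF c] _ phi(2)[OF c]] y c R_Ch v by simp
    then have "\<delta> y (\<phi> c) = \<one>"
      unfolding right_cancel[OF v G_carrier[OF R_dist[OF y(1) phi(1)[OF c]]] one_closed] .
    then show ?thesis using WD1[of y "\<phi> c"] R_Ch y phi(1)[OF c] by simp
  qed
  \<comment> \<open>This makes the condition \<open>\<delta> y (\<theta> c) = v\<close> symmetric in
    \<open>y\<close> and \<open>c\<close>, so \<open>\<phi>\<close> is an involution.\<close>
  have sigma_v: "inv (\<sigma> v) = v"
  proof -
    have "\<sigma> m = w \<otimes> (m \<otimes> w)"
      using w by (simp add: m_def sigma_mult sigma_conj m_assoc ww')
    then have "\<sigma> v = w \<otimes> (m \<otimes> w) \<otimes> w" using m w by (simp add: v_def sigma_mult sigma_w)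
    also have "\<dots> = w \<otimes> m" using m w ww by (simp add: m_assoc)
    finally show ?thesis using m w by (simp add: v_def inv_mult_group inv_m inv_w)
  qed
  have phi_phi: "\<phi> (\<phi> c) = c" if c: "c \<in> R" for c
  proof -
    have C: "c \<in> Ch" "\<phi> c \<in> Ch" using c phi(1) R_Ch by auto
    have "\<delta> (\<theta> (\<phi> c)) c = \<sigma> v" using dist_theta[of "\<phi> c" "\<theta> c"] phi(2)[OF c] C by simp
    then have "\<delta> c (\<theta> (\<phi> c)) = v" using dist_inv[of "\<theta> (\<phi> c)" c] C sigma_v by simp
    then show ?thesis using phi_unique[OF phi(1)[OF c] c] by simp
  qed
  \<comment> \<open>Comparing \<open>w = \<delta> c (\<phi> c) v\<close> with \<open>w = m v\<close>
    shows that \<open>c\<close> and its image are opposite in \<open>R\<close>; this excludes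
    absolute points.\<close>
  have phi_opp: "\<delta> c (\<phi> c) = m" if c: "c \<in> R" for c
  proof -
    have "w = \<delta> c (\<phi> c) \<otimes> v"
      using to_v[OF c phi(1)[OF c] _ phi(2)[OF c]] disp R_Ch[OF c] by simp
    then have "m \<otimes> v = \<delta> c (\<phi> c) \<otimes> v" using mv by simp
    then show ?thesis using m v G_carrier[OF R_dist[OF c phi(1)[OF c]]] by simp
  qed
  have phi_adj: "\<delta> (\<phi> c) (\<phi> d) \<in> {\<one>, r'}"
    if c: "c \<in> R" and d: "d \<in> R" and cd: "\<delta> c d \<in> {\<one>, r}" and r: "r \<in> S" and r': "r' \<in> S" "m \<otimes> r = r' \<otimes> m" for c d r r'
  proof (cases "c = d")
    case True
    then show ?thesis using phi(1)[OF c] R_Ch by simp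
  next
    case False
    have C: "c \<in> Ch" "d \<in> Ch" "\<phi> c \<in> Ch" "\<phi> d \<in> Ch" using c d phi(1) R_Ch by auto
    have "\<delta> c d = r" using cd WD1[OF C(1,2)] False by blast
    then have "\<delta> (\<theta> c) (\<theta> d) = \<sigma> r" using dist_theta[OF C(1,2)] by simp
    from dist_gen_cases[OF C(3) theta_closed[OF C(1)] theta_closed[OF C(2)] this sigma_gen[OF r]]
    have "\<delta> (\<phi> c) (\<theta> d) = v \<or> \<delta> (\<phi> c) (\<theta> d) = v \<otimes> \<sigma> r" unfolding phi(2)[OF c] .
    \<comment> \<open>The conjugations by \<open>w\<close> in \<open>\<sigma>\<close> and in
      \<open>v = m w\<close> cancel, leaving conjugation by \<open>m\<close>.\<close>
    moreover have "v \<otimes> \<sigma> r = r' \<otimes> v"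
    proof -
      have "v \<otimes> \<sigma> r = m \<otimes> r \<otimes> w" using m w r by (simp add: v_def sigma_conj[OF r] m_assoc ww')
      also have "\<dots> = r' \<otimes> v" using r' m w by (simp add: v_def m_assoc)
      finally show ?thesis .
    qed
    moreover have "\<delta> (\<phi> c) (\<theta> d) = \<delta> (\<phi> c) (\<phi> d) \<otimes> v"
      using to_v[OF phi(1)[OF c] phi(1)[OF d] theta_closed[OF C(2)] phi(2)[OF d]] .
    ultimately have "\<delta> (\<phi> c) (\<phi> d) \<otimes> v = \<one> \<otimes> v \<or> \<delta> (\<phi> c) (\<phi> d) \<otimes> v = r' \<otimes> v" using v by auto
    then show ?thesis using v r' dist_closed[OF C(3,4)] by auto
  qed
  have gen_s: "generate W {s} = {\<one>, s}" and gen_t: "generate W {t} = {\<one>, t}"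
    using generate_single by auto
  have long: "s \<otimes> t \<notin> {\<one>, s}" "m \<notin> {\<one>, s}"
    using bond(3,5) len_gen[OF s] len_one unfolding m_def by fastforce+
  show False
  proof (rule no_polarity_without_absolute_points[of R \<phi> "\<lambda>c d. \<delta> c d \<in> {\<one>, s}" "\<lambda>c d. \<delta> c d \<in> {\<one>, t}"])
    show "finite R" using fin by (simp add: R_def)
    show "R \<noteq> {}" using x0 subgroup.one_closed[OF G_sub] by (auto simp: R_def)
  next
    fix c d assume "c \<in> R" "d \<in> R" "\<delta> c d \<in> {\<one>, s}"
    then show "\<delta> d c \<in> {\<one>, s}" using residue_sym[of "{s}" c d] R_Ch by (simp add: gen_s)
  next
    fix c d e assume "c \<in> R" "d \<in> R" "e \<in> R" "\<delta> c d \<in> {\<one>, s}" "\<delta> d e \<in> {\<one>, s}"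
    then show "\<delta> c e \<in> {\<one>, s}" using residue_trans[of "{s}" c d e] R_Ch by (simp add: gen_s)
  next
    fix c d assume "c \<in> R" "d \<in> R" "\<delta> c d \<in> {\<one>, s}" "\<delta> c d \<in> {\<one>, t}"
    then show "c = d" using bond(2) WD1[of c d] R_Ch by auto
  next
    fix c d assume "c \<in> R" "d \<in> R" "\<delta> c d \<in> {\<one>, s}"
    then show "\<delta> (\<phi> c) (\<phi> d) \<in> {\<one>, t}" using phi_adj m_swap s t by blast
  next
    fix c d assume "c \<in> R" "d \<in> R" "\<delta> c d \<in> {\<one>, t}"
    then show "\<delta> (\<phi> c) (\<phi> d) \<in> {\<one>, s}" using phi_adj m_swap s t by blast
  next
    fix c assume "c \<in> R"
    then show "\<delta> c (\<phi> c) \<notin> {\<one>, s}" using phi_opp long by simp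
  next
    fix c d assume c: "c \<in> R" and d: "d \<in> R" and nps: "\<delta> c d \<notin> {\<one>, s}"
    have C: "c \<in> Ch" "d \<in> Ch" using c d R_Ch by auto
    have self: "\<delta> c c \<in> {\<one>, s}" "\<delta> d d \<in> {\<one>, s}" using C by auto
    \<comment> \<open>The four remaining distances come from \<open>s t s\<close> by omitting outer
      letters. Walking along the letters that are present gives two flags on the line joining the
      points of \<open>c\<close> and \<open>d\<close>.\<close>
    from G_cases[OF R_dist[OF c d]] nps
    consider "\<delta> c d = t" | "\<delta> c d = s \<otimes> t" | "\<delta> c d = t \<otimes> s" | "\<delta> c d = s \<otimes> (t \<otimes> s)" by blast
    then show "\<exists>c'\<in>R. \<exists>d'\<in>R. \<delta> c c' \<in> {\<one>, s} \<and> \<delta> c' d' \<in> {\<one>, t} \<and> \<delta> d' d \<in> {\<one>, s}"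
    proof cases
      case 1
      then show ?thesis using c d self by blast
    next
      case 2
      obtain c' where c': "c' \<in> Ch" "\<delta> c c' = s" "\<delta> c' d = s \<otimes> \<delta> c d"
        using ex_step[OF C s] by metis
      then have "c' \<in> R" "\<delta> c' d = t" using R_step[OF c] sG 2 by simp_all
      then show ?thesis using c' d self by blast
    next
      case 3
      obtain d' where d': "d' \<in> Ch" "\<delta> c d' = t" "\<delta> d' d = t \<otimes> \<delta> c d"
        using ex_step[OF C t] by metis
      then have "d' \<in> R" "\<delta> d' d = s" using R_step[OF c] tG 3 by simp_all
      then show ?thesis using d' c self by blast
    next
      case 4
      obtain c' where c': "c' \<in> Ch" "\<delta> c c' = s" "\<delta> c' d = s \<otimes> \<delta> c d"
        using ex_step[OF C s] by metis
      then have c'R: "c' \<in> R" and c'd: "\<delta> c' d = t \<otimes> s" using R_step[OF c] sG 4 by simp_all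
      obtain d' where d': "d' \<in> Ch" "\<delta> c' d' = t" "\<delta> d' d = t \<otimes> \<delta> c' d"
        using ex_step[OF c'(1) C(2) t] by metis
      then have "d' \<in> R" "\<delta> d' d = s" using R_step[OF c'R] tG c'd by simp_all
      then show ?thesis using c'R c' d' by blast
    qed
  next
    fix c c' d d'
    assume R: "c \<in> R" "c' \<in> R" "d \<in> R" "d' \<in> R"
      and cc': "\<delta> c c' \<in> {\<one>, s}" and dd': "\<delta> d d' \<in> {\<one>, s}"
      and cd: "\<delta> c d \<in> {\<one>, t}" and c'd': "\<delta> c' d' \<in> {\<one>, t}" and nps: "\<delta> c d \<notin> {\<one>, s}"
    have C: "c \<in> Ch" "c' \<in> Ch" "d \<in> Ch" "d' \<in> Ch" using R R_Ch by auto
    show "c = c'"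
    proof (rule ccontr)
      \<comment> \<open>The chambers \<open>d\<close>, \<open>c\<close>, \<open>c'\<close>,
        \<open>d'\<close> would form a gallery of the reduced type \<open>t s t\<close>, so
        \<open>d\<close> and \<open>d'\<close> would be at distance \<open>m\<close> instead of
        lying in a common \<open>s\<close>-panel.\<close>
      assume "c \<noteq> c'"
      then have 1: "\<delta> c c' = s" using cc' WD1[OF C(1,2)] by blast
      have 2: "\<delta> d c = t" using cd nps dist_gen_sym[OF C(1,3)] t by auto
      have "\<delta> c' d' \<noteq> \<one>"
      proof
        assume "\<delta> c' d' = \<one>"
        then have "c' = d'" using WD1[OF C(2,4)] by simp
        then have "\<delta> c d' \<in> generate W {s}" "\<delta> d' d \<in> generate W {s}"
          using cc' dd' residue_sym[of "{s}" d d'] C by (simp_all add: gen_s)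
        then show False using residue_trans[of "{s}" c d' d] C nps by (simp add: gen_s)
      qed
      then have 3: "\<delta> c' d' = t" using c'd' by blast
      have 4: "\<delta> d c' = t \<otimes> s" using dist_mult[OF C(3,1,2)] 1 2 bond(4) len_gen[OF s] len_gen[OF t] by simp
      have tst: "t \<otimes> s \<otimes> t = m" using bond(1) by (simp add: m_def m_assoc)
      have "\<delta> d d' = m"
        using dist_mult[OF C(3,2,4)] 3 4 tst bond(4,5) len_gen[OF t] by (simp add: m_def)
      then show False using dd' long by simp
    qed
  next
    fix c assume c: "c \<in> R"
    define P where "P = {y \<in> Ch. \<delta> c y \<in> generate W {s}}"
    have "is_residue W Ch \<delta> {s} P" using R_Ch[OF c] unfolding is_residue_def P_def by blast
    then have "infinite P \<or> 3 \<le> card P" using thick s unfolding thick_def by blast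
    moreover have "finite P" using fin by (simp add: P_def)
    moreover have "P = {y \<in> R. \<delta> c y \<in> {\<one>, s}}"
      using R_step[OF c] genG[of _ s] R_Ch unfolding P_def gen_s by blast
    ultimately show "3 \<le> card {y \<in> R. \<delta> c y \<in> {\<one>, s}}" by simp
  qed (use phi phi_phi R_Ch in simp_all)
qed

end

theorem corollary5p5:
  fixes W :: "('w, 'm) monoid_scheme" and S :: "'w set"
    and Ch :: "'c set" and \<delta> :: "'c \<Rightarrow> 'c \<Rightarrow> 'w" and \<theta> :: "'c \<Rightarrow> 'c"
  assumes "spherical_building W S Ch \<delta>"
    and "building_involution W S Ch \<delta> \<theta>"
  shows "((\<forall>x\<in>Ch. opposite W S \<delta> x (\<theta> x)) \<or> fixes_simplex W S Ch \<delta> \<theta>) \<and>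
    (finite Ch \<and> coxeter_irreducible W S \<and> thick W S Ch \<delta> \<and> 3 \<le> card S
      \<longrightarrow> fixes_simplex W S Ch \<delta> \<theta>)"
proof -
  obtain \<sigma> where sigma: "\<sigma> \<in> iso W W" "\<sigma> ` S = S" "\<forall>x\<in>Ch. \<forall>y\<in>Ch. \<delta> (\<theta> x) (\<theta> y) = \<sigma> (\<delta> x y)"
    and bij: "bij_betw \<theta> Ch Ch" and invol: "\<forall>x\<in>Ch. \<theta> (\<theta> x) = x"
    using assms(2) unfolding building_involution_def building_automorphism_def by blast
  interpret spherical_building W S Ch \<delta> by (rule assms(1))
  interpret spherical_building_involution W S Ch \<delta> \<theta> \<sigma>
    by unfold_locales (use sigma invol bij_betwE[OF bij] in auto)
  note dichotomy = all_opposite_or_fixes_simplex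
  show ?thesis
  proof (intro conjI impI dichotomy)
    assume fin: "finite Ch \<and> coxeter_irreducible W S \<and> thick W S Ch \<delta> \<and> 3 \<le> card S"
    then obtain s t where "s \<in> S" "t \<in> S" "ord (s \<otimes>\<^bsub>W\<^esub> t) = 3"
      using ex_bond_3[OF finite_type] by blast
    then show "fixes_simplex W S Ch \<delta> \<theta>" using dichotomy not_all_opposite fin by blast
  qed
qed

end
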